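(* Let $P$ be the transition matrix of the random walk on a finite connected undirected (possibly weighted) graph $G$, let $s$ be its stationary distribution, and let $\alpha,\beta$ be the spectral quantities of $P$ defined in the context. Let $f$ be a real function on the vertices of $G$ with $\max_i|f(i)|=1$ and $\sum_i f(i)s(i)=0$, and let $V=\sum_i f(i)^2s(i)$. Let $q$ be any probability distribution on the vertices, let $(X_i)_{i\ge 0}$ be the walk with $X_0\sim q$, and let $S_n=\sum_{i=1}^n f(X_i)$. Let $n\ge1$ be an integer, $\gamma>0$ and $t\ge 1$ real numbers. (i) Suppose $\beta<1$, put $C_\beta=2\frac{1+\beta^2}{1-\beta^2}$, and suppose $\gamma\le (t-1)\frac{1+\beta^2}{\beta^2}V$ (no restriction on $\gamma$ if $\beta=0$). Then $$\mathbb{P}_q\left(\frac1n S_n>\gamma\right)\le\left\|\frac{q}{\sqrt s}\right\|_2\exp\left(-\frac n2\,tC_\beta V\left[\left(1+\frac{\gamma}{tC_\beta V}\right)\log\left(1+\frac{\gamma}{tC_\beta V}\right)-\frac{\gamma}{tC_\beta V}\right]\right)\le\left\|\frac{q}{\sqrt s}\right\|_2\exp\left(-\frac n2\,\gamma\log\frac{\gamma}{etC_\beta V}\right).$$ (ii) Put $C_\alpha=2\frac{1+\alpha}{1-\alpha}$, and suppose $\gamma\le (t-1)\frac{1+\alpha}{\alpha}V$ (no restriction on $\gamma$ if $\alpha=0$). Then $$\mathbb{P}_q\left(\frac1n S_n>\gamma\right)\le\left(1+\frac{\gamma}{tC_\alpha V}\right)\left\|\frac{q}{\sqrt s}\right\|_2\exp\left(-n\,tC_\alpha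 V\left[\left(1+\frac{\gamma}{tC_\alpha V}\right)\log\left(1+\frac{\gamma}{tC_\alpha V}\right)-\frac{\gamma}{tC_\alpha V}\right]\right)$$ $$\le\left(1+\frac{\gamma}{tC_\alpha V}\right)\left\|\frac{q}{\sqrt s}\right\|_2\exp\left(-n\,\gamma\log\frac{\gamma}{etC_\alpha V}\right).$$
   Context: $G$ is a finite undirected, possibly weighted (with positive edge weights), connected graph with $N$ vertices; random walks on such graphs represent exactly the finite irreducible reversible Markov chains. $P_{ij}$ is the probability of moving from vertex $j$ to vertex $i$ (so the columns of $P$ sum to $1$). $s$ is the unique stationary distribution, $Ps=s$, with $s(i)>0$ for all $i$; reversibility means $s(j)P_{ij}=s(i)P_{ji}$ for all $i,j$. The eigenvalues of $P$ are all real; the top eigenvalue is $1$, it is simple, and all other eigenvalues have absolute value at most $1$. $\alpha<1$ is the maximum of $0$ and the second largest eigenvalue of $P$. $\beta\le 1$ is the second largest absolute value of an eigenvalue of $P$, i.e. the largest absolute value among the eigenvalues other than the simple eigenvalue $1$. $X_0,X_1,\ldots$ is the trajectory of the walk (Markov chain with transition matrix $P$) with starting distribution $q$, and $\mathbb{P}_q$ is the corresponding probability. Expressions in vectors are coordinatewise, so $\left\|\frac{q}{\sqrt s}\right\|_2=\left(\sum_i q(i)^2/s(i)\right)^{1/2}$. $\log$ is the natural logarithm. *)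

theory Defs
  imports "HOL-Probability.Probability"
begin

text \<open>
  A finite undirected weighted graph on the vertex type \<open>'v\<close> is given by its weight function:
  \<open>w i j > 0\<close> is the weight of the edge between \<open>i\<close> and \<open>j\<close>, and \<open>w i j = 0\<close> means that there is
  no edge. An unweighted graph has weights 0 and 1. Loops (\<open>w i i > 0\<close>) are allowed, so that the
  random walks are exactly the finite irreducible reversible Markov chains.
\<close>

definition weighted_graph :: "('v \<Rightarrow> 'v \<Rightarrow> real) \<Rightarrow> bool" where
  "weighted_graph w \<longleftrightarrow> (\<forall>i j. 0 \<le> w i j) \<and> (\<forall>i j. w i j = w j i)"

definition connected_graph :: "('v \<Rightarrow> 'v \<Rightarrow> real) \<Rightarrow> bool" where
  "connected_graph w \<longleftrightarrow> (\<forall>i j. (\<lambda>x y. 0 < w x y)\<^sup>*\<^sup>* i j)"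

text \<open>Column convention: the entry \<open>$ i $ j\<close> is the probability of moving from \<open>j\<close> to \<open>i\<close>.\<close>

definition transition_matrix :: "('v::finite \<Rightarrow> 'v \<Rightarrow> real) \<Rightarrow> real^'v^'v" where
  "transition_matrix w = (\<chi> i j. w j i / (\<Sum>k\<in>UNIV. w j k))"

definition prob_vector :: "real^'v::finite \<Rightarrow> bool" where
  "prob_vector p \<longleftrightarrow> (\<forall>i. 0 \<le> p $ i) \<and> (\<Sum>i\<in>UNIV. p $ i) = 1"

definition stationary_distribution :: "real^'v^'v::finite \<Rightarrow> real^'v \<Rightarrow> bool" where
  "stationary_distribution P s \<longleftrightarrow> prob_vector s \<and> P *v s = s"

text \<open>Real eigenvalues suffice, since the transition matrices above have only real ones.\<close>

definition eigenvalues :: "real^'v^'v::finite \<Rightarrow> real set" where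
  "eigenvalues A = {l. \<exists>v. v \<noteq> 0 \<and> A *v v = l *\<^sub>R v}"

text \<open>
  For the random walk on a connected graph, the top eigenvalue 1 is simple, so the remaining
  spectrum is \<open>eigenvalues P - {1}\<close>. It is nonempty if there are at least two vertices.
\<close>

definition spectral_alpha :: "real^'v^'v::finite \<Rightarrow> real" where
  "spectral_alpha P = max 0 (Max (eigenvalues P - {1}))"

definition spectral_beta :: "real^'v^'v::finite \<Rightarrow> real" where
  "spectral_beta P = Max (abs ` (eigenvalues P - {1}))"

definition markov_trajectory ::
    "'w measure \<Rightarrow> real^'v^'v::finite \<Rightarrow> real^'v \<Rightarrow> (nat \<Rightarrow> 'w \<Rightarrow> 'v) \<Rightarrow> bool" where
  "markov_trajectory M P q X \<longleftrightarrow>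
     prob_space M \<and>
     (\<forall>n. X n \<in> measurable M (count_space UNIV)) \<and>
     (\<forall>i. \<P>(\<omega> in M. X 0 \<omega> = i) = q $ i) \<and>
     (\<forall>n x i. \<P>(\<omega> in M. \<forall>k\<le>n. X k \<omega> = x k) > 0 \<longrightarrow>
        \<P>(\<omega> in M. X (Suc n) \<omega> = i \<bar> \<forall>k\<le>n. X k \<omega> = x k) = P $ i $ x n)"

end

theory Submission
  imports Defs
begin

text \<open>
  Let \<open>A = D P D\<inverse>\<close> with \<open>D = diag (1 / sqrt s)\<close>. By reversibility \<open>A\<close> is symmetric; it has the spectrum
  of \<open>P\<close> and fixes the unit vector \<open>e = sqrt s\<close>. Connectedness makes the eigenvalue 1 simple, so that on the
  complement of \<open>e\<close> the quadratic form of \<open>A\<close> is at most \<open>\<alpha>\<close> and that of \<open>A\<^sup>2\<close> at most \<open>\<beta>\<^sup>2\<close>. On the whole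
  space, each of the two forms is thus dominated by \<open>(1 - a) (x \<bullet> e)\<^sup>2 + a \<parallel>x\<parallel>\<^sup>2\<close>, with \<open>a = \<alpha>\<close> or
  \<open>a = \<beta>\<^sup>2\<close> (\<open>spectral_alpha_bounds\<close>, \<open>spectral_beta_bounds\<close>).

  Exponential moments of the walk are products of matrices: summing over the last position,
  the expectation of \<open>exp (\<eta> S\<^sub>n)\<close> is \<open>e \<bullet> (G A)\<^sup>n (q / sqrt s)\<close> with \<open>G = diag (exp (\<eta> f))\<close>
  (\<open>exponential_moment_markov\<close>). Chernoff's bound therefore reduces the theorem to an operator norm:
  \<^item> for \<open>\<beta>\<close>, take \<open>\<eta> = \<theta> / 2\<close>; then \<open>\<parallel>G A\<parallel>\<^sup>2 = \<parallel>A G\<parallel>\<^sup>2\<close> is the maximum of the form of \<open>A\<^sup>2\<close> at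
    \<open>G x\<close> over unit vectors \<open>x\<close>;
  \<^item> for \<open>\<alpha>\<close>, take \<open>\<eta> = \<theta>\<close>, so that \<open>G = H\<^sup>2\<close> with \<open>H = diag (exp (\<theta> f / 2))\<close>, and move one factor \<open>H\<close>
    through the product, which costs the factor \<open>exp \<theta>\<close>. What remains is the symmetric matrix \<open>H A H\<close>.
    As its entries are nonnegative, its norm is the maximum of its quadratic form, so one-sided control of the spectrum is enough.

  In both cases \<open>\<theta> = ln (1 + u)\<close>, the form is evaluated at \<open>H x\<close>, and it remains to bound the top eigenvalue of the
  rank-one perturbation \<open>(1 - a) (H e) (H e)\<^sup>T + a H\<^sup>2\<close> of a diagonal matrix. A number \<open>\<Lambda>\<close> above the
  diagonal is an upper bound once the secular function
  \<open>(1 - a) \<Sum>i. s i z i / (\<Lambda> - a z i)\<close>, where \<open>z i = exp (\<theta> f i)\<close>, is at most 1. Expanding it to second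
  order at \<open>z = 1\<close>, the first-order term of \<open>f\<close> drops out by \<open>\<Sum>i. f i s i = 0\<close>, the second-order terms are
  bounded by multiples of \<open>V\<close>, and \<open>\<Lambda> = exp (t C V (u - ln (1 + u)))\<close> suffices
  (\<open>secular_equation_bound\<close>, \<open>tilted_rank_one_bound\<close>). With \<open>u = \<gamma> / (t C V)\<close> the exponents combine to
  Bennett's function \<open>(1 + u) ln (1 + u) - u\<close>.
\<close>

section \<open>Rayleigh quotients of self-adjoint maps\<close>

text \<open>
  The part of the spectral theorem needed here: on an invariant hyperplane, a
  maximiser of the Rayleigh quotient over the compact unit sphere is an eigenvector, because otherwise
  the quotient increases in the direction of the residual \<open>B y - \<mu> y\<close>.
\<close>

lemma rayleigh_maximiser:
  fixes B :: "'a::euclidean_space \<Rightarrow> 'a"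
  assumes lin: "linear B"
    and selfadj: "\<And>x y. x \<bullet> B y = B x \<bullet> y"
    and inv: "\<And>x. x \<bullet> e = 0 \<Longrightarrow> B x \<bullet> e = 0"
    and z: "z \<noteq> 0" "z \<bullet> e = 0"
  obtains y \<mu> where "norm y = 1" "y \<bullet> e = 0" "B y = \<mu> *\<^sub>R y"
    "\<And>x. x \<bullet> e = 0 \<Longrightarrow> x \<bullet> B x \<le> \<mu> * (norm x)\<^sup>2"
proof -
  interpret B: linear B by (rule lin)
  define K where "K = sphere (0::'a) 1 \<inter> {x. e \<bullet> x = 0}"
  have "compact K"
    unfolding K_def by (intro compact_Int_closed closed_hyperplane) simp
  moreover have "inverse (norm z) *\<^sub>R z \<in> K"
    using z by (simp add: K_def inner_commute)
  then have "K \<noteq> {}" by blast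
  moreover have "continuous_on K (\<lambda>x. x \<bullet> B x)"
    using linear_continuous_on[OF B.linear_axioms[unfolded linear_conv_bounded_linear]]
    by (intro continuous_intros)
  ultimately obtain y where y: "y \<in> K" "\<And>x. x \<in> K \<Longrightarrow> x \<bullet> B x \<le> y \<bullet> B y"
    using continuous_attains_sup by metis
  define \<mu> where "\<mu> = y \<bullet> B y"
  have ny: "norm y = 1" and ye: "y \<bullet> e = 0"
    using y(1) by (auto simp: K_def inner_commute)
  have yy: "y \<bullet> y = 1" using ny by (simp add: norm_eq_1)
  have bound: "x \<bullet> B x \<le> \<mu> * (norm x)\<^sup>2" if "x \<bullet> e = 0" for x
  proof (cases "x = 0")
    case False
    let ?c = "inverse (norm x)"
    have "?c *\<^sub>R x \<in> K" using that False by (simp add: K_def inner_commute)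
    from y(2)[OF this] have "?c * (?c * (x \<bullet> B x)) \<le> \<mu>"
      by (simp add: B.scaleR \<mu>_def)
    then show ?thesis using False by (simp add: field_simps power2_eq_square)
  qed simp
  define R where "R = B y - \<mu> *\<^sub>R y"
  have Re: "R \<bullet> e = 0" using inv[OF ye] ye by (simp add: R_def inner_diff_left)
  \<comment> \<open>The first-order condition: the residual \<open>R\<close> is an admissible direction of ascent.\<close>
  have "R = 0"
  proof (rule ccontr)
    assume "R \<noteq> 0"
    then have Rpos: "0 < R \<bullet> R" by simp
    define c where "c = \<mu> * (R \<bullet> R) - R \<bullet> B R"
    define \<epsilon> where "\<epsilon> = (R \<bullet> R) / (\<bar>c\<bar> + 1)"
    have eps: "0 < \<epsilon>" using Rpos by (simp add: \<epsilon>_def)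
    have RB: "R \<bullet> B y - \<mu> * (y \<bullet> R) = R \<bullet> R"
      by (subst (4) R_def) (simp add: inner_diff_right inner_commute)
    have "(y + \<epsilon> *\<^sub>R R) \<bullet> B (y + \<epsilon> *\<^sub>R R) \<le> \<mu> * (norm (y + \<epsilon> *\<^sub>R R))\<^sup>2"
      using ye Re by (intro bound) (simp add: inner_add_left)
    moreover have "(y + \<epsilon> *\<^sub>R R) \<bullet> B (y + \<epsilon> *\<^sub>R R)
        = \<mu> + 2 * \<epsilon> * (R \<bullet> B y) + \<epsilon> * \<epsilon> * (R \<bullet> B R)"
      using selfadj[of y R]
      by (simp add: B.add B.scaleR inner_add_left inner_add_right \<mu>_def inner_commute algebra_simps)
    moreover have "(norm (y + \<epsilon> *\<^sub>R R))\<^sup>2 = 1 + 2 * \<epsilon> * (y \<bullet> R) + \<epsilon> * \<epsilon> * (R \<bullet> R)"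
      unfolding power2_norm_eq_inner
      by (simp add: inner_add_left inner_add_right yy inner_commute algebra_simps)
    ultimately have "2 * \<epsilon> * (R \<bullet> B y - \<mu> * (y \<bullet> R)) \<le> \<epsilon> * \<epsilon> * c"
      by (simp add: c_def algebra_simps)
    then have "\<epsilon> * (2 * (R \<bullet> R)) \<le> \<epsilon> * (\<epsilon> * c)" by (simp add: RB mult_ac)
    then have "2 * (R \<bullet> R) \<le> \<epsilon> * c" using eps by (simp only: mult_le_cancel_left_pos)
    also have "\<epsilon> * c \<le> \<epsilon> * (\<bar>c\<bar> + 1)" using eps by (intro mult_left_mono) auto
    also have "\<dots> = R \<bullet> R" by (simp add: \<epsilon>_def add_nonneg_eq_0_iff)
    finally show False using Rpos by simp
  qed
  then have "B y = \<mu> *\<^sub>R y" by (simp add: R_def)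
  then show thesis using that ny ye bound by blast
qed

text \<open>
  Splitting \<open>x\<close> along \<open>e\<close> and its complement, both sides lose their mixed terms.
\<close>

lemma quadratic_form_bound_rank_one:
  fixes B :: "'a::real_inner \<Rightarrow> 'a"
  assumes lin: "linear B" and selfadj: "\<And>x y. x \<bullet> B y = B x \<bullet> y"
    and e: "norm e = 1" "B e = e"
    and gap: "\<And>y. y \<bullet> e = 0 \<Longrightarrow> y \<bullet> B y \<le> a * (norm y)\<^sup>2"
  shows "x \<bullet> B x \<le> (1 - a) * (x \<bullet> e)\<^sup>2 + a * (norm x)\<^sup>2"
proof -
  interpret B: linear B by (rule lin)
  have ee: "e \<bullet> e = 1" using e by (simp add: norm_eq_1)
  define c where "c = x \<bullet> e"
  define y where "y = x - c *\<^sub>R e"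
  have ye: "y \<bullet> e = 0" by (simp add: y_def inner_diff_left c_def ee)
  have x: "x = c *\<^sub>R e + y" by (simp add: y_def)
  have "e \<bullet> B y = 0" using selfadj[of e y] e ye by (simp add: inner_commute)
  then have "x \<bullet> B x = c\<^sup>2 + y \<bullet> B y"
    using ye by (simp add: x B.add B.scaleR e inner_add_left inner_add_right ee power2_eq_square)
  moreover have "x \<bullet> x = c * c + y \<bullet> y"
    using ye unfolding x by (simp add: inner_add_left inner_add_right ee inner_commute)
  then have "(norm x)\<^sup>2 = c\<^sup>2 + (norm y)\<^sup>2"
    by (simp only: power2_norm_eq_inner power2_eq_square[of c])
  ultimately show ?thesis using gap[OF ye] by (simp add: c_def[symmetric] algebra_simps)
qed

text \<open>
  Polarisation: \<open>4 (z \<bullet> B x)\<close> is the difference of the form at \<open>z + x\<close> and \<open>z - x\<close>, tested with the multiple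
  \<open>z\<close> of \<open>B x\<close> that has the length of \<open>x\<close>.
\<close>

lemma norm_bound_of_quadratic_form:
  fixes B :: "'a::real_inner \<Rightarrow> 'a"
  assumes lin: "linear B" and selfadj: "\<And>x y. x \<bullet> B y = B x \<bullet> y"
    and quad: "\<And>x. \<bar>x \<bullet> B x\<bar> \<le> c * (norm x)\<^sup>2" and c: "0 \<le> c"
  shows "norm (B x) \<le> c * norm x"
proof (cases "B x = 0")
  case False
  interpret B: linear B by (rule lin)
  define r where "r = norm (B x)"
  define z where "z = (norm x / r) *\<^sub>R B x"
  have r: "0 < r" using False by (simp add: r_def)
  have x0: "0 < norm x" using False B.zero by auto
  have nz: "norm z = norm x" using r by (simp add: z_def r_def)
  have "4 * (z \<bullet> B x) = (z + x) \<bullet> B (z + x) - (z - x) \<bullet> B (z - x)"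
    using selfadj[of x z]
    by (simp add: B.add B.diff inner_add_left inner_add_right inner_diff_left inner_diff_right
        inner_commute)
  also have "\<dots> \<le> c * (norm (z + x))\<^sup>2 + c * (norm (z - x))\<^sup>2"
    using quad[of "z + x"] quad[of "z - x"] by linarith
  also have "\<dots> = c * (2 * (norm z)\<^sup>2 + 2 * (norm x)\<^sup>2)"
    by (simp add: power2_norm_eq_inner inner_add_left inner_add_right inner_diff_left
        inner_diff_right inner_commute algebra_simps)
  finally have "z \<bullet> B x \<le> c * (norm x)\<^sup>2" by (simp add: nz)
  moreover have "z \<bullet> B x = norm x * r"
    using r by (simp add: z_def r_def power2_norm_eq_inner[symmetric] power2_eq_square)
  ultimately have "norm x * r \<le> norm x * (c * norm x)" by (simp add: power2_eq_square mult_ac)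
  then show ?thesis using x0 by (simp add: r_def)
qed (use c in simp)

section \<open>Exponential inequalities\<close>

text \<open>
  In terms of \<open>v = ln (1 + u)\<close> this is \<open>v \<le> sinh v\<close>.
\<close>

lemma quadratic_le_exp_minus_one_minus_self:
  fixes u :: real
  assumes "0 \<le> u"
  shows "u\<^sup>2 / (2 * (1 + u)) \<le> u - ln (1 + u)"
proof -
  define v where "v = ln (1 + u)"
  have v: "0 \<le> v" "exp v = 1 + u" using assms by (auto simp: v_def)
  have "v \<le> (1 + u - inverse (1 + u)) / 2" using real_le_x_sinh[OF v(1)] by (simp add: v)
  then have "u - v \<ge> u - (1 + u - inverse (1 + u)) / 2" by simp
  moreover have "u - (1 + u - inverse (1 + u)) / 2 = u\<^sup>2 / (2 * (1 + u))"
    using assms by (simp add: field_simps power2_eq_square)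
  ultimately show ?thesis by (simp add: v_def)
qed

text \<open>
  After the linear term, every term of the exponential series carries at least a factor \<open>x\<^sup>2\<close> and otherwise
  powers of \<open>x\<close> that are at most 1.
\<close>

lemma exp_le_quadratic_interpolation:
  fixes \<theta> x :: real
  assumes "0 \<le> \<theta>" "\<bar>x\<bar> \<le> 1"
  shows "exp (\<theta> * x) - 1 \<le> \<theta> * x + (exp \<theta> - 1 - \<theta>) * x\<^sup>2"
proof -
  let ?g = "\<lambda>y n. inverse (fact (n + 2)) *\<^sub>R (y ^ (n + 2) :: real)"
  have sm: "summable (?g y)" for y
    using summable_ignore_initial_segment[OF summable_exp_generic[of y], of 2] by simp
  have "(\<Sum>n. ?g (\<theta> * x) n) \<le> (\<Sum>n. x\<^sup>2 * ?g \<theta> n)"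
  proof (rule suminf_le)
    fix n
    have "x ^ n \<le> 1"
      using power_le_one[of "\<bar>x\<bar>" n] assms by (simp add: power_abs[symmetric])
    then have "x ^ (n + 2) \<le> x\<^sup>2"
      using mult_right_mono[of "x ^ n" 1 "x\<^sup>2"] by (simp only: power_add mult_1_left zero_le_power2)
    then have "(\<theta> ^ (n + 2)) * (x ^ (n + 2)) \<le> \<theta> ^ (n + 2) * x\<^sup>2"
      using assms by (intro mult_left_mono) auto
    then show "?g (\<theta> * x) n \<le> x\<^sup>2 * ?g \<theta> n"
      using mult_left_mono[of _ _ "inverse (fact (n + 2)) :: real"]
      by (simp only: power_mult_distrib real_scaleR_def mult_ac) simp
  qed (use sm in \<open>auto intro!: summable_mult\<close>)
  also have "\<dots> = x\<^sup>2 * (\<Sum>n. ?g \<theta> n)" by (rule suminf_mult) (rule sm)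
  finally show ?thesis
    using exp_first_two_terms[of "\<theta> * x"] exp_first_two_terms[of \<theta>] by (simp add: mult_ac)
qed

lemma abs_exp_minus_one_le:
  fixes \<theta> x :: real
  assumes "0 \<le> \<theta>" "\<bar>x\<bar> \<le> 1"
  shows "\<bar>exp (\<theta> * x) - 1\<bar> \<le> \<bar>x\<bar> * (exp \<theta> - 1)"
proof -
  have pos: "exp (\<theta> * y) - 1 \<le> y * (exp \<theta> - 1)" if "0 \<le> y" "y \<le> 1" for y
  proof -
    have "exp ((1 - y) *\<^sub>R 0 + y *\<^sub>R \<theta>) \<le> (1 - y) * exp 0 + y * exp \<theta>"
      using that by (intro convex_onD[OF exp_convex]) auto
    then show ?thesis by (simp add: algebra_simps)
  qed
  have "\<bar>exp z - 1\<bar> \<le> exp \<bar>z\<bar> - 1" for z :: real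
  proof (cases "0 \<le> z")
    case False
    have "2 \<le> exp z + inverse (exp z)"
      using sum_squares_bound[of 1 "exp z"]
      by (simp add: field_simps power2_eq_square)
    with False show ?thesis by (simp add: exp_minus abs_if)
  qed simp
  from this[of "\<theta> * x"] pos[of "\<bar>x\<bar>"] assms show ?thesis by (simp add: abs_mult)
qed

text \<open>
  The first term on the left is the one for independent samples, the second is the price of the correlations.
  The budget \<open>small\<close> keeps \<open>a (1 + u)\<close> at most \<open>(1 + a) / 2\<close>, away from the pole of the
  correlation term, and \<open>u\<^sup>2 \<le> 2 (1 + u) (u - ln (1 + u))\<close> makes that term comparable to the first.
\<close>

lemma bennett_loss_bound:
  fixes a t u :: real
  assumes a: "0 \<le> a" "a < 1" and t: "1 \<le> t" and u: "0 \<le> u"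
    and small: "2 * a * u * t \<le> (t - 1) * (1 - a)"
  shows "a * (1 + u) < 1"
    and "(u - ln (1 + u)) + a * u\<^sup>2 / (1 - a * (1 + u))
          \<le> t * (2 * ((1 + a) / (1 - a))) * (u - ln (1 + u))"
proof -
  have au: "0 \<le> a * u" using a u by simp
  have "t * (2 * (a * u)) \<le> t * (1 - a)"
    using small a by (simp add: algebra_simps)
  then have half: "2 * (a * u) \<le> 1 - a" using t by (simp add: mult_le_cancel_left)
  with a show lt: "a * (1 + u) < 1" by (simp add: algebra_simps)
  define d where "d = 1 - a * (1 + u)"
  define \<delta> where "\<delta> = u - ln (1 + u)"
  have d: "0 < d" using lt by (simp add: d_def)
  have quad: "u\<^sup>2 / (2 * (1 + u)) \<le> \<delta>"
    using quadratic_le_exp_minus_one_minus_self[OF u] by (simp add: \<delta>_def)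
  then have u2: "u\<^sup>2 \<le> 2 * (1 + u) * \<delta>" using u by (simp add: field_simps)
  have delta: "0 \<le> \<delta>" using u by (intro order_trans[OF _ quad]) simp
  have "(d + 2 * a * (1 + u)) * (1 - a) \<le> (2 * (1 + a)) * (1 - a)"
    using half a by (intro mult_right_mono) (auto simp: d_def algebra_simps)
  also have "\<dots> \<le> (1 + a) * ((t + 1) * (1 - a))"
    using t a mult_right_mono[of 2 "t + 1" "(1 + a) * (1 - a)"] by (simp add: mult_ac)
  also have "(t + 1) * (1 - a) \<le> 2 * t * d"
    using small by (simp add: d_def algebra_simps)
  then have "(1 + a) * ((t + 1) * (1 - a)) \<le> (1 + a) * (2 * t * d)"
    using a by (intro mult_left_mono) auto
  finally have "(d + 2 * a * (1 + u)) / d \<le> t * (2 * ((1 + a) / (1 - a)))"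
    using d a by (simp add: field_simps)
  then have "(d + 2 * a * (1 + u)) / d * \<delta> \<le> t * (2 * ((1 + a) / (1 - a))) * \<delta>"
    using delta by (rule mult_right_mono)
  moreover have "\<delta> + a * u\<^sup>2 / d \<le> (d + 2 * a * (1 + u)) / d * \<delta>"
    using divide_right_mono[OF mult_left_mono[OF u2 a(1)], of d] d
    by (simp add: add_divide_distrib distrib_left distrib_right mult_ac)
  ultimately show "(u - ln (1 + u)) + a * u\<^sup>2 / (1 - a * (1 + u))
          \<le> t * (2 * ((1 + a) / (1 - a))) * (u - ln (1 + u))"
    by (simp add: \<delta>_def d_def)
qed

text \<open>
  The hypothesis on \<open>\<gamma>\<close>, restated for \<open>u = \<gamma> / (t C V)\<close> without division by \<open>a\<close>: this form
  is trivial for \<open>a = 0\<close>, so that no later argument distinguishes the case.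
\<close>

lemma spectral_budget:
  fixes a t V \<gamma> :: real
  assumes a: "0 \<le> a" "a < 1" and t: "1 \<le> t" and V: "0 < V"
    and \<gamma>: "a \<noteq> 0 \<Longrightarrow> \<gamma> \<le> (t - 1) * ((1 + a) / a) * V"
  shows "2 * a * (\<gamma> / (t * (2 * ((1 + a) / (1 - a))) * V)) * t \<le> (t - 1) * (1 - a)"
proof (cases "a = 0")
  case False
  with a have a0: "0 < a" by simp
  have "a * \<gamma> \<le> (t - 1) * (1 + a) * V" using \<gamma>[OF False] a0 by (simp add: field_simps)
  then have "(1 - a) * (a * \<gamma>) \<le> (1 - a) * ((t - 1) * (1 + a) * V)"
    using a by (intro mult_left_mono) auto
  then have "(1 - a) * (a * \<gamma>) / ((1 + a) * V) \<le> (t - 1) * (1 - a)"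
    using a V by (subst pos_divide_le_eq) (simp_all add: mult_ac)
  moreover have "2 * a * (\<gamma> / (t * (2 * ((1 + a) / (1 - a))) * V)) * t
      = (1 - a) * (a * \<gamma>) / ((1 + a) * V)"
    using a t V by (simp add: divide_simps)
  ultimately show ?thesis by simp
qed (use t in simp)

lemma bennett_exponent_ge:
  fixes K \<gamma> :: real
  assumes K: "0 < K" and \<gamma>: "0 < \<gamma>"
  shows "\<gamma> * ln (\<gamma> / (exp 1 * K)) \<le> K * ((1 + \<gamma> / K) * ln (1 + \<gamma> / K) - \<gamma> / K)"
proof -
  define u where "u = \<gamma> / K"
  have u: "0 < u" "\<gamma> = K * u" using assms by (auto simp: u_def)
  have "\<gamma> * ln (\<gamma> / (exp 1 * K)) = K * (u * ln u - u)"
    using u K by (simp add: ln_div ln_mult algebra_simps)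
  also have "u * ln u \<le> u * ln (1 + u)" using u by (intro mult_left_mono) auto
  then have "u * ln u - u \<le> (1 + u) * ln (1 + u) - u"
    unfolding distrib_right mult_1_left using u ln_ge_zero[of "1 + u"] by linarith
  then have "K * (u * ln u - u) \<le> K * ((1 + u) * ln (1 + u) - u)"
    using K by (intro mult_left_mono) auto
  finally show ?thesis by (simp add: u_def)
qed

section \<open>The top eigenvalue of a tilted rank-one perturbation\<close>

text \<open>
  The function \<open>z / (\<Lambda> - a z)\<close> is convex with a pole at \<open>\<Lambda> / a\<close>. Its exact expansion at \<open>z = 1\<close> has
  the mean of \<open>z - 1\<close> as first-order and a multiple of the mean of \<open>(z - 1)\<^sup>2 / (\<Lambda> - a z)\<close> as second-order term.
  Both are estimated by multiples of \<open>V\<close>, and \<open>\<Lambda> \<ge> 1\<close> allows replacing \<open>\<Lambda>\<close> by 1 in the denominator.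
\<close>

lemma secular_equation_bound:
  fixes s f :: "'v::finite \<Rightarrow> real" and a t u V :: real
  defines "\<theta> \<equiv> ln (1 + u)"
  defines "\<Lambda> \<equiv> exp (t * (2 * ((1 + a) / (1 - a))) * V * (u - \<theta>))"
  assumes s: "\<And>i. 0 \<le> s i" "(\<Sum>i\<in>UNIV. s i) = 1"
    and f: "\<And>i. \<bar>f i\<bar> \<le> 1" "(\<Sum>i\<in>UNIV. f i * s i) = 0" "V = (\<Sum>i\<in>UNIV. (f i)\<^sup>2 * s i)"
    and a: "0 \<le> a" "a < 1" and t: "1 \<le> t" and u: "0 \<le> u"
    and small: "2 * a * u * t \<le> (t - 1) * (1 - a)"
  shows "a * exp (\<theta> * f i) < \<Lambda>"
    and "(1 - a) * (\<Sum>i\<in>UNIV. s i * exp (\<theta> * f i) / (\<Lambda> - a * exp (\<theta> * f i))) \<le> 1"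
proof -
  define z where "z = (\<lambda>i. exp (\<theta> * f i))"
  define K where "K = t * (2 * ((1 + a) / (1 - a))) * V * (u - \<theta>)"
  have \<theta>: "0 \<le> \<theta>" "exp \<theta> = 1 + u" using u by (auto simp: \<theta>_def)
  note loss = bennett_loss_bound[OF a t u small]
  have V: "0 \<le> V" unfolding f(3) by (intro sum_nonneg mult_nonneg_nonneg s) auto
  have "0 \<le> u - \<theta>" using ln_add_one_self_le_self[OF u] by (simp add: \<theta>_def)
  then have K: "0 \<le> K" using V a t by (simp add: K_def)
  have \<Lambda>K: "1 + K \<le> \<Lambda>" unfolding \<Lambda>_def K_def by (rule exp_ge_add_one_self)
  have \<Lambda>1: "1 \<le> \<Lambda>" using \<Lambda>K K by linarith
  have z_le: "z i \<le> 1 + u" for i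
  proof -
    have "\<theta> * f i \<le> \<theta> * 1" using f(1)[of i] \<theta> by (intro mult_left_mono) auto
    then show ?thesis using \<theta> exp_le_cancel_iff[of "\<theta> * f i" \<theta>] by (simp add: z_def)
  qed
  have az: "a * z i \<le> a * (1 + u)" for i using z_le a by (intro mult_left_mono)
  have den: "1 - a * (1 + u) \<le> \<Lambda> - a * z i" for i using az[of i] \<Lambda>1 by linarith
  have den0: "0 < 1 - a * (1 + u)" using loss(1) by simp
  have pos: "0 < \<Lambda> - a * z i" for i using den[of i] den0 by linarith
  show "a * exp (\<theta> * f i) < \<Lambda>" using pos[of i] by (simp add: z_def)
  have point: "(z i - 1) + a * (z i - 1)\<^sup>2 / (\<Lambda> - a * z i)
      \<le> \<theta> * f i + ((u - \<theta>) + a * u\<^sup>2 / (1 - a * (1 + u))) * (f i)\<^sup>2" for i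
  proof -
    have "z i - 1 \<le> \<theta> * f i + (u - \<theta>) * (f i)\<^sup>2"
      using exp_le_quadratic_interpolation[OF \<theta>(1) f(1)[of i]] \<theta> by (simp add: z_def)
    moreover have "(z i - 1)\<^sup>2 \<le> (f i)\<^sup>2 * u\<^sup>2"
    proof -
      have "\<bar>z i - 1\<bar> \<le> \<bar>f i\<bar> * u"
        using abs_exp_minus_one_le[OF \<theta>(1) f(1)[of i]] \<theta> by (simp add: z_def)
      then have "\<bar>z i - 1\<bar>\<^sup>2 \<le> (\<bar>f i\<bar> * u)\<^sup>2" by (intro power_mono) auto
      then show ?thesis by (simp add: power_mult_distrib)
    qed
    then have "a * (z i - 1)\<^sup>2 / (\<Lambda> - a * z i) \<le> a * ((f i)\<^sup>2 * u\<^sup>2) / (1 - a * (1 + u))"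
      using a den[of i] den0 by (intro frac_le mult_left_mono) auto
    ultimately show ?thesis by (simp add: algebra_simps)
  qed
  have "(\<Sum>i\<in>UNIV. s i * ((z i - 1) + a * (z i - 1)\<^sup>2 / (\<Lambda> - a * z i)))
      \<le> (\<Sum>i\<in>UNIV. s i * (\<theta> * f i + ((u - \<theta>) + a * u\<^sup>2 / (1 - a * (1 + u))) * (f i)\<^sup>2))"
    by (intro sum_mono mult_left_mono point s)
  also have "\<dots> = \<theta> * (\<Sum>i\<in>UNIV. f i * s i)
      + ((u - \<theta>) + a * u\<^sup>2 / (1 - a * (1 + u))) * (\<Sum>i\<in>UNIV. (f i)\<^sup>2 * s i)"
    unfolding sum_distrib_left sum.distrib[symmetric] by (simp only: distrib_left mult_ac)
  also have "\<dots> = ((u - \<theta>) + a * u\<^sup>2 / (1 - a * (1 + u))) * V" using f by simp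
  also have "\<dots> \<le> t * (2 * ((1 + a) / (1 - a))) * (u - \<theta>) * V"
    using loss(2) V by (intro mult_right_mono) (auto simp: \<theta>_def)
  also have "\<dots> = K" by (simp add: K_def)
  also have "K \<le> \<Lambda> - 1" using \<Lambda>K by simp
  finally have mean: "(\<Sum>i\<in>UNIV. s i * ((z i - 1) + a * (z i - 1)\<^sup>2 / (\<Lambda> - a * z i))) \<le> \<Lambda> - 1" .
  \<comment> \<open>Taylor expansion of \<open>z / (\<Lambda> - a z)\<close> at \<open>z = 1\<close> with its exact second-order remainder.\<close>
  have expand: "(\<Lambda> - a)\<^sup>2 * (z i / (\<Lambda> - a * z i))
      = (\<Lambda> - a) + \<Lambda> * ((z i - 1) + a * (z i - 1)\<^sup>2 / (\<Lambda> - a * z i))" for i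
  proof -
    have "(\<Lambda> - a)\<^sup>2 * z i
      = (\<Lambda> - a) * (\<Lambda> - a * z i) + \<Lambda> * ((z i - 1) * (\<Lambda> - a * z i) + a * (z i - 1)\<^sup>2)"
      by algebra
    then show ?thesis using pos[of i] by (simp add: field_simps)
  qed
  define T where "T = (\<Sum>i\<in>UNIV. s i * z i / (\<Lambda> - a * z i))"
  have "(\<Lambda> - a)\<^sup>2 * T = (\<Sum>i\<in>UNIV. s i * ((\<Lambda> - a)\<^sup>2 * (z i / (\<Lambda> - a * z i))))"
    by (simp add: T_def sum_distrib_left mult_ac)
  also have "\<dots> = (\<Lambda> - a) * (\<Sum>i\<in>UNIV. s i)
      + \<Lambda> * (\<Sum>i\<in>UNIV. s i * ((z i - 1) + a * (z i - 1)\<^sup>2 / (\<Lambda> - a * z i)))"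
    unfolding expand by (simp add: sum_distrib_left sum.distrib distrib_left mult_ac)
  also have "\<dots> \<le> (\<Lambda> - a) + \<Lambda> * (\<Lambda> - 1)"
    using mean \<Lambda>1 s by (simp add: mult_left_mono)
  finally have "(1 - a) * ((\<Lambda> - a)\<^sup>2 * T) \<le> (1 - a) * ((\<Lambda> - a) + \<Lambda> * (\<Lambda> - 1))"
    using a by (intro mult_left_mono) auto
  also have "\<dots> = (\<Lambda> - a)\<^sup>2 - a * (\<Lambda> - 1)\<^sup>2" by algebra
  also have "\<dots> \<le> (\<Lambda> - a)\<^sup>2 * 1" using a by simp
  finally have "(\<Lambda> - a)\<^sup>2 * ((1 - a) * T) \<le> (\<Lambda> - a)\<^sup>2 * 1" by (simp only: mult_ac)
  moreover have "0 < (\<Lambda> - a)\<^sup>2" using \<Lambda>1 a by simp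
  ultimately have "(1 - a) * T \<le> 1" by (simp only: mult_le_cancel_left_pos)
  then show "(1 - a) * (\<Sum>i\<in>UNIV. s i * exp (\<theta> * f i) / (\<Lambda> - a * exp (\<theta> * f i))) \<le> 1"
    by (simp add: T_def z_def)
qed

definition diag_mult :: "('v \<Rightarrow> real) \<Rightarrow> real^'v \<Rightarrow> real^'v::finite" where
  "diag_mult g x = (\<chi> i. g i * x $ i)"

lemma diag_mult_nth [simp]: "diag_mult g x $ i = g i * x $ i"
  by (simp add: diag_mult_def)

lemma linear_diag_mult: "linear (diag_mult g)"
  by (rule linearI) (simp_all add: vec_eq_iff algebra_simps)

lemma diag_mult_selfadjoint: "x \<bullet> diag_mult g y = diag_mult g x \<bullet> y"
  by (simp add: inner_vec_def mult_ac)

lemma diag_mult_diag_mult: "diag_mult g (diag_mult h x) = diag_mult (\<lambda>i. g i * h i) x"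
  by (simp add: vec_eq_iff mult_ac)

lemma norm_diag_mult_le:
  assumes "\<And>i. \<bar>g i\<bar> \<le> c"
  shows "norm (diag_mult g x) \<le> c * norm x"
proof -
  have "norm (diag_mult g x) \<le> norm (c *\<^sub>R x)"
    using assms by (intro norm_le_componentwise_cart)
      (auto simp: abs_mult intro!: mult_right_mono order_trans[OF assms])
  also have "\<dots> = c * norm x" using order_trans[OF abs_ge_zero assms] by simp
  finally show ?thesis .
qed

text \<open>
  Cauchy--Schwarz with the weights \<open>d i = \<Lambda> - a z i\<close>: they are chosen such that adding the diagonal part
  \<open>a z i\<close> gives exactly \<open>\<Lambda>\<close>, and the dual weights sum to the secular function.
\<close>

lemma tilted_rank_one_bound:
  fixes s :: "real^'v::finite" and f :: "'v \<Rightarrow> real" and a t u V :: real and x :: "real^'v"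
  defines "\<theta> \<equiv> ln (1 + u)"
  defines "\<Lambda> \<equiv> exp (t * (2 * ((1 + a) / (1 - a))) * V * (u - \<theta>))"
  defines "y \<equiv> diag_mult (\<lambda>i. exp (\<theta> / 2 * f i)) x"
  assumes s: "\<And>i. 0 \<le> s $ i" "(\<Sum>i\<in>UNIV. s $ i) = 1"
    and f: "\<And>i. \<bar>f i\<bar> \<le> 1" "(\<Sum>i\<in>UNIV. f i * s $ i) = 0" "V = (\<Sum>i\<in>UNIV. (f i)\<^sup>2 * s $ i)"
    and a: "0 \<le> a" "a < 1" and t: "1 \<le> t" and u: "0 \<le> u"
    and small: "2 * a * u * t \<le> (t - 1) * (1 - a)"
  shows "(1 - a) * (y \<bullet> (\<chi> i. sqrt (s $ i)))\<^sup>2 + a * (norm y)\<^sup>2 \<le> \<Lambda> * (norm x)\<^sup>2"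
proof -
  define z where "z = (\<lambda>i. exp (\<theta> * f i))"
  define d where "d = (\<lambda>i. \<Lambda> - a * z i)"
  note secular = secular_equation_bound[OF s f a t u small, folded \<theta>_def, folded \<Lambda>_def]
  have d: "0 < d i" for i using secular(1)[of i] by (simp add: d_def z_def)
  have y2: "(y $ i)\<^sup>2 = z i * (x $ i)\<^sup>2" for i
    by (simp add: y_def z_def power_mult_distrib exp_double[symmetric])
  have zpos: "0 < z i" for i by (simp add: z_def)
  have y_nth: "y $ i = sqrt (z i) * x $ i" for i
    using y2[of i] by (simp add: y_def z_def real_sqrt_unique[of "exp (\<theta> / 2 * f i)"] exp_double[symmetric])
  have "(y \<bullet> (\<chi> i. sqrt (s $ i)))\<^sup>2
      = (\<Sum>i\<in>UNIV. (x $ i * sqrt (d i)) * sqrt (s $ i * z i / d i))\<^sup>2"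
    using d by (simp add: inner_vec_def y_nth real_sqrt_mult real_sqrt_divide
        less_imp_neq[symmetric] mult_ac)
  also have "\<dots> \<le> (\<Sum>i\<in>UNIV. (x $ i * sqrt (d i))\<^sup>2) * (\<Sum>i\<in>UNIV. (sqrt (s $ i * z i / d i))\<^sup>2)"
    by (rule Cauchy_Schwarz_ineq_sum)
  also have "(\<Sum>i\<in>UNIV. (x $ i * sqrt (d i))\<^sup>2) = (\<Sum>i\<in>UNIV. d i * (x $ i)\<^sup>2)"
    using d by (simp add: power_mult_distrib less_imp_le mult_ac)
  also have "(\<Sum>i\<in>UNIV. (sqrt (s $ i * z i / d i))\<^sup>2) = (\<Sum>i\<in>UNIV. s $ i * z i / d i)"
    using d s zpos by (simp add: less_imp_le)
  finally have "(1 - a) * (y \<bullet> (\<chi> i. sqrt (s $ i)))\<^sup>2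
      \<le> (1 - a) * ((\<Sum>i\<in>UNIV. d i * (x $ i)\<^sup>2) * (\<Sum>i\<in>UNIV. s $ i * z i / d i))"
    using a by (intro mult_left_mono) auto
  also have "\<dots> = (\<Sum>i\<in>UNIV. d i * (x $ i)\<^sup>2) * ((1 - a) * (\<Sum>i\<in>UNIV. s $ i * z i / d i))"
    by (simp only: mult_ac)
  also have "\<dots> \<le> (\<Sum>i\<in>UNIV. d i * (x $ i)\<^sup>2) * 1"
    using secular(2) d by (intro mult_left_mono sum_nonneg) (auto simp: d_def z_def less_imp_le)
  finally have "(1 - a) * (y \<bullet> (\<chi> i. sqrt (s $ i)))\<^sup>2 \<le> (\<Sum>i\<in>UNIV. d i * (x $ i)\<^sup>2)" by simp
  moreover have "(norm y)\<^sup>2 = (\<Sum>i\<in>UNIV. z i * (x $ i)\<^sup>2)"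
    by (simp add: power2_norm_eq_inner inner_vec_def y2 power2_eq_square[symmetric])
  moreover have "(norm x)\<^sup>2 = (\<Sum>i\<in>UNIV. (x $ i)\<^sup>2)"
    by (simp add: power2_norm_eq_inner inner_vec_def power2_eq_square[symmetric])
  ultimately show ?thesis
    by (simp add: d_def sum_distrib_left sum.distrib sum_subtractf left_diff_distrib mult_ac)
qed

section \<open>Spectral gap of a reversible chain\<close>

text \<open>
  One step of the distribution, reweighted at the arrival point. Its iterates carry the exponential moments of
  an additive functional, split up by the current position.
\<close>

definition tilted_step :: "real^'v^'v \<Rightarrow> ('v \<Rightarrow> real) \<Rightarrow> real^'v \<Rightarrow> real^'v::finite" where
  "tilted_step P g x = diag_mult g (P *v x)"

lemma tilted_step_nth: "tilted_step P g x $ i = g i * (\<Sum>j\<in>UNIV. P $ i $ j * x $ j)"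
  by (simp add: tilted_step_def matrix_vector_mult_def)

text \<open>
  Irreducibility is expressed by \<open>simple\<close>, the form in which the spectral argument uses it: the eigenvalue 1
  has a one-dimensional eigenspace.
\<close>

locale reversible_chain =
  fixes P :: "real^'v^'v::finite" and s :: "real^'v"
  assumes s_pos: "0 < s $ i"
    and s_sum: "(\<Sum>i\<in>UNIV. s $ i) = 1"
    and P_nonneg: "0 \<le> P $ i $ j"
    and P_columns: "(\<Sum>i\<in>UNIV. P $ i $ j) = 1"
    and reversible: "s $ j * P $ i $ j = s $ i * P $ j $ i"
    and simple: "P *v v = v \<Longrightarrow> \<exists>c. v = c *\<^sub>R s"
begin

text \<open>
  The symmetric matrix conjugate to \<open>P\<close>; the vector \<open>e\<close> below is its unit top eigenvector.
\<close>

definition A :: "real^'v^'v" where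
  "A = (\<chi> i j. P $ i $ j * sqrt (s $ j) / sqrt (s $ i))"

definition e :: "real^'v" where
  "e = (\<chi> i. sqrt (s $ i))"

abbreviation symmetrised :: "real^'v \<Rightarrow> real^'v" where
  "symmetrised \<equiv> diag_mult (\<lambda>i. 1 / sqrt (s $ i))"

lemma s_simps [simp]: "0 < s $ i" "0 \<le> s $ i" "s $ i \<noteq> 0"
  using s_pos[of i] by auto

lemma A_sym: "A $ i $ j = A $ j $ i"
proof -
  have "A $ i $ j = (s $ j * P $ i $ j) / (sqrt (s $ i) * sqrt (s $ j))" for i j
  proof -
    have "P $ i $ j * sqrt (s $ j) = (s $ j * P $ i $ j) / sqrt (s $ j)"
      by (simp add: field_simps)
    then show ?thesis by (simp add: A_def mult.commute)
  qed
  then show ?thesis using reversible[of j i] by (simp add: mult.commute)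
qed

lemma A_nonneg: "0 \<le> A $ i $ j"
  using s_pos P_nonneg by (simp add: A_def less_imp_le)

lemma A_selfadjoint: "x \<bullet> (A *v y) = (A *v x) \<bullet> y"
proof -
  have "transpose A = A" by (simp add: transpose_def vec_eq_iff A_sym)
  then show ?thesis by (metis dot_lmul_matrix transpose_matrix_vector)
qed

lemma A_symmetrised: "A *v symmetrised x = symmetrised (P *v x)"
proof -
  have "A $ i $ j * (x $ j / sqrt (s $ j)) = P $ i $ j * x $ j / sqrt (s $ i)" for i j
    by (simp add: A_def)
  then show ?thesis by (simp add: vec_eq_iff matrix_vector_mult_def sum_divide_distrib)
qed

lemma symmetrised_inverse: "symmetrised (diag_mult (\<lambda>i. sqrt (s $ i)) x) = x"
  by (simp add: vec_eq_iff)

lemma A_eigenvector: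
  assumes "A *v x = l *\<^sub>R x"
  shows "P *v (diag_mult (\<lambda>i. sqrt (s $ i)) x) = l *\<^sub>R diag_mult (\<lambda>i. sqrt (s $ i)) x"
proof -
  let ?v = "diag_mult (\<lambda>i. sqrt (s $ i)) x"
  have "symmetrised (P *v ?v) = l *\<^sub>R x"
    using A_symmetrised[of ?v] assms by (simp only: symmetrised_inverse)
  then show ?thesis by (simp add: vec_eq_iff field_simps)
qed

lemma eigenvalues_A: "l \<in> eigenvalues P \<longleftrightarrow> (\<exists>x. x \<noteq> 0 \<and> A *v x = l *\<^sub>R x)"
proof
  assume "l \<in> eigenvalues P"
  then obtain v where v: "v \<noteq> 0" "P *v v = l *\<^sub>R v" by (auto simp: eigenvalues_def)
  have "A *v symmetrised v = l *\<^sub>R symmetrised v"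
    unfolding A_symmetrised v(2) by (simp add: vec_eq_iff)
  moreover have "symmetrised v \<noteq> 0" using v(1) by (simp add: vec_eq_iff)
  ultimately show "\<exists>x. x \<noteq> 0 \<and> A *v x = l *\<^sub>R x" by blast
next
  assume "\<exists>x. x \<noteq> 0 \<and> A *v x = l *\<^sub>R x"
  then obtain x where x: "x \<noteq> 0" "A *v x = l *\<^sub>R x" by blast
  have "diag_mult (\<lambda>i. sqrt (s $ i)) x \<noteq> 0" using x(1) by (simp add: vec_eq_iff)
  then show "l \<in> eigenvalues P" using A_eigenvector[OF x(2)] by (auto simp: eigenvalues_def)
qed

lemma e_unit: "e \<bullet> e = 1" "norm e = 1"
  by (simp_all add: e_def inner_vec_def s_sum norm_eq_1)

lemma e_fixed: "A *v e = e"
proof -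
  have "(\<Sum>j\<in>UNIV. P $ i $ j * s $ j) = s $ i" for i
    using sum_distrib_left[of "s $ i" "\<lambda>j. P $ j $ i" UNIV]
    by (simp add: P_columns reversible[symmetric] mult.commute)
  then have "P *v s = s" by (simp add: vec_eq_iff matrix_vector_mult_def)
  moreover have "e = symmetrised s"
    by (simp add: vec_eq_iff e_def field_simps)
  ultimately show ?thesis by (simp add: A_symmetrised)
qed

text \<open>
  Simplicity of the eigenvalue 1, seen from the orthogonal complement of \<open>e\<close>.
\<close>

lemma A_simple:
  assumes "A *v x = x" "x \<bullet> e = 0"
  shows "x = 0"
proof -
  let ?v = "diag_mult (\<lambda>i. sqrt (s $ i)) x"
  have "P *v ?v = ?v" using A_eigenvector[of x 1] assms by simp
  then obtain c where c: "?v = c *\<^sub>R s" using simple by blast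
  have "x $ i = c * e $ i" for i
  proof -
    have "sqrt (s $ i) * x $ i = sqrt (s $ i) * (c * sqrt (s $ i))"
      using arg_cong[OF c, of "\<lambda>v. v $ i"] by simp
    then show ?thesis by (simp add: e_def)
  qed
  then have x: "x = c *\<^sub>R e" by (simp add: vec_eq_iff)
  then have "c = 0" using assms(2) e_unit by simp
  then show ?thesis by (simp add: x)
qed

text \<open>
  A column-stochastic matrix does not increase the \<open>l\<^sup>1\<close> norm.
\<close>

lemma abs_eigenvalue_le_1:
  assumes "l \<in> eigenvalues P"
  shows "\<bar>l\<bar> \<le> 1"
proof -
  obtain v where v: "v \<noteq> 0" "P *v v = l *\<^sub>R v" using assms by (auto simp: eigenvalues_def)
  have "\<bar>l\<bar> * (\<Sum>i\<in>UNIV. \<bar>v $ i\<bar>) = (\<Sum>i\<in>UNIV. \<bar>(P *v v) $ i\<bar>)"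
    by (simp add: v(2) abs_mult sum_distrib_left)
  also have "\<dots> \<le> (\<Sum>i\<in>UNIV. \<Sum>j\<in>UNIV. P $ i $ j * \<bar>v $ j\<bar>)"
    unfolding matrix_vector_mult_def
    by (auto intro!: sum_mono order_trans[OF sum_abs] simp: abs_mult P_nonneg)
  also have "\<dots> = (\<Sum>j\<in>UNIV. \<bar>v $ j\<bar>)"
    by (subst sum.swap) (simp add: sum_distrib_right[symmetric] P_columns)
  finally have "\<bar>l\<bar> * (\<Sum>i\<in>UNIV. \<bar>v $ i\<bar>) \<le> 1 * (\<Sum>i\<in>UNIV. \<bar>v $ i\<bar>)" by simp
  moreover have "0 < (\<Sum>i\<in>UNIV. \<bar>v $ i\<bar>)"
    using v(1) by (auto simp: vec_eq_iff intro!: sum_pos2)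
  ultimately show ?thesis by (simp only: mult_le_cancel_right_pos)
qed

text \<open>
  Eigenvectors of a symmetric matrix for distinct eigenvalues are orthogonal, hence independent. Finiteness is
  what makes the maxima in the definitions of \<open>\<alpha>\<close> and \<open>\<beta>\<close> meaningful.
\<close>

lemma finite_eigenvalues: "finite (eigenvalues P)"
proof -
  obtain x where x: "\<And>l. l \<in> eigenvalues P \<Longrightarrow> x l \<noteq> 0 \<and> A *v x l = l *\<^sub>R x l"
    using eigenvalues_A by metis
  have orth: "orthogonal (x l) (x m)" if "l \<in> eigenvalues P" "m \<in> eigenvalues P" "l \<noteq> m" for l m
  proof -
    have "m * (x l \<bullet> x m) = l * (x l \<bullet> x m)"
      using A_selfadjoint[of "x l" "x m"] x that by simp
    then show ?thesis using that by (simp add: orthogonal_def)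
  qed
  have inj: "inj_on x (eigenvalues P)"
  proof (rule inj_onI, rule ccontr)
    fix l m assume lm: "l \<in> eigenvalues P" "m \<in> eigenvalues P" "x l = x m" "l \<noteq> m"
    then show False using orth[of l m] x[of m] by (simp add: orthogonal_def)
  qed
  have "independent (x ` eigenvalues P)"
    using orth x by (intro pairwise_orthogonal_independent) (auto simp: pairwise_def)
  then have "finite (x ` eigenvalues P)" by (rule independent_imp_finite)
  then show ?thesis using inj by (rule finite_imageD)
qed

lemma linear_A: "linear ((*v) A)" by simp

lemma orthogonal_invariant: "x \<bullet> e = 0 \<Longrightarrow> (A *v x) \<bullet> e = 0"
  using A_selfadjoint[of x e] e_fixed by simp

text \<open>
  The maximum of the Rayleigh quotient of \<open>A\<close> on the complement of \<open>e\<close> is an eigenvalue other than 1, hence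
  at most \<open>\<alpha>\<close>. The vector \<open>z\<close> ensures that this complement is nontrivial, so that there is a second
  eigenvalue at all.
\<close>

lemma spectral_alpha_bounds:
  assumes z: "z \<noteq> 0" "z \<bullet> e = 0"
  shows "0 \<le> spectral_alpha P" "spectral_alpha P < 1"
    and "x \<bullet> (A *v x) \<le> (1 - spectral_alpha P) * (x \<bullet> e)\<^sup>2 + spectral_alpha P * (norm x)\<^sup>2"
proof -
  obtain y \<mu> where y: "norm y = 1" "y \<bullet> e = 0" "A *v y = \<mu> *\<^sub>R y"
    and max: "\<And>x. x \<bullet> e = 0 \<Longrightarrow> x \<bullet> (A *v x) \<le> \<mu> * (norm x)\<^sup>2"
    using rayleigh_maximiser[of "(*v) A" e z] linear_A A_selfadjoint orthogonal_invariant z by metis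
  have "\<mu> \<noteq> 1" using A_simple[of y] y by auto
  moreover have "\<mu> \<in> eigenvalues P" using y by (auto simp: eigenvalues_A intro!: exI[of _ y])
  ultimately have \<mu>: "\<mu> \<in> eigenvalues P - {1}" by simp
  have fin: "finite (eigenvalues P - {1})" using finite_eigenvalues by simp
  have "\<mu> \<le> spectral_alpha P"
    unfolding spectral_alpha_def using Max_ge[OF fin \<mu>] by simp
  then have "x \<bullet> (A *v x) \<le> spectral_alpha P * (norm x)\<^sup>2" if "x \<bullet> e = 0" for x
    using max[OF that] mult_right_mono[of \<mu> "spectral_alpha P" "(norm x)\<^sup>2"] by simp
  then show "x \<bullet> (A *v x) \<le> (1 - spectral_alpha P) * (x \<bullet> e)\<^sup>2 + spectral_alpha P * (norm x)\<^sup>2"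
    by (intro quadratic_form_bound_rank_one linear_A A_selfadjoint e_unit e_fixed)
  show "0 \<le> spectral_alpha P" by (simp add: spectral_alpha_def)
  have "l < 1" if "l \<in> eigenvalues P - {1}" for l
    using abs_eigenvalue_le_1[of l] that by force
  then have "Max (eigenvalues P - {1}) < 1" using fin \<mu> by (subst Max_less_iff) auto
  then show "spectral_alpha P < 1" by (simp add: spectral_alpha_def)
qed

text \<open>
  The same argument for \<open>A\<^sup>2\<close>; its maximal eigenvalue on the complement of \<open>e\<close> is the square of an eigenvalue
  of \<open>A\<close> other than 1.
\<close>

lemma spectral_beta_bounds:
  assumes z: "z \<noteq> 0" "z \<bullet> e = 0"
  shows "0 \<le> spectral_beta P"
    and "(norm (A *v x))\<^sup>2 \<le> (1 - (spectral_beta P)\<^sup>2) * (x \<bullet> e)\<^sup>2 + (spectral_beta P)\<^sup>2 * (norm x)\<^sup>2"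
proof -
  let ?B = "\<lambda>x. A *v (A *v x)"
  have linB: "linear ?B" by (simp add: matrix_vector_mul_assoc)
  have saB: "x \<bullet> ?B y = ?B x \<bullet> y" for x y by (simp add: A_selfadjoint)
  have invB: "x \<bullet> e = 0 \<Longrightarrow> ?B x \<bullet> e = 0" for x by (intro orthogonal_invariant)
  have quadB: "x \<bullet> ?B x = (norm (A *v x))\<^sup>2" for x
    by (simp add: A_selfadjoint power2_norm_eq_inner)
  obtain y \<mu> where y: "norm y = 1" "y \<bullet> e = 0" "?B y = \<mu> *\<^sub>R y"
    and max: "\<And>x. x \<bullet> e = 0 \<Longrightarrow> x \<bullet> ?B x \<le> \<mu> * (norm x)\<^sup>2"
    using rayleigh_maximiser[of ?B e z] linB saB invB z by metis
  have "y \<bullet> ?B y = \<mu>" using y by (simp add: norm_eq_1)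
  then have \<mu>0: "0 \<le> \<mu>" using quadB[of y] by (metis zero_le_power2)
  define \<nu> where "\<nu> = sqrt \<mu>"
  have \<nu>: "0 \<le> \<nu>" "\<nu> * \<nu> = \<mu>" using \<mu>0 by (auto simp: \<nu>_def)
  \<comment> \<open>Factor \<open>A\<^sup>2 - \<mu> = (A - \<nu>) (A + \<nu>)\<close>: one of \<open>\<nu>\<close> and \<open>-\<nu>\<close> is an eigenvalue other than 1.\<close>
  define r where "r = A *v y + \<nu> *\<^sub>R y"
  have r: "A *v r = \<nu> *\<^sub>R r" "r \<bullet> e = 0"
    using y orthogonal_invariant[OF y(2)] \<nu>
    by (auto simp: r_def matrix_vector_right_distrib matrix_vector_mult_scaleR inner_add_left
        scaleR_right_distrib)
  have fin: "finite (abs ` (eigenvalues P - {1}))" using finite_eigenvalues by simp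
  have \<nu>mem: "\<nu> \<in> abs ` (eigenvalues P - {1})"
  proof (cases "r = 0")
    case True
    then have "A *v y = (- \<nu>) *\<^sub>R y" by (simp add: r_def eq_neg_iff_add_eq_0)
    then have "- \<nu> \<in> eigenvalues P" using y(1) by (auto simp: eigenvalues_A intro!: exI[of _ y])
    then show ?thesis using \<nu> by (intro image_eqI[of _ _ "- \<nu>"]) auto
  next
    case False
    then have "\<nu> \<in> eigenvalues P" using r by (auto simp: eigenvalues_A)
    moreover have "\<nu> \<noteq> 1" using A_simple[of r] r False by auto
    ultimately show ?thesis using \<nu> by (intro image_eqI[of _ _ \<nu>]) auto
  qed
  have le: "\<nu> \<le> spectral_beta P" unfolding spectral_beta_def by (rule Max_ge[OF fin \<nu>mem])
  then show "0 \<le> spectral_beta P" using \<nu> by simp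
  have "\<mu> \<le> (spectral_beta P)\<^sup>2"
    using power_mono[OF le \<nu>(1), of 2] \<nu>(2) by (simp add: power2_eq_square)
  then have "x \<bullet> ?B x \<le> (spectral_beta P)\<^sup>2 * (norm x)\<^sup>2" if "x \<bullet> e = 0" for x
    using max[OF that] mult_right_mono[of \<mu> "(spectral_beta P)\<^sup>2" "(norm x)\<^sup>2"] by simp
  then have "x \<bullet> ?B x \<le> (1 - (spectral_beta P)\<^sup>2) * (x \<bullet> e)\<^sup>2 + (spectral_beta P)\<^sup>2 * (norm x)\<^sup>2"
    by (intro quadratic_form_bound_rank_one linB saB e_unit) (simp_all add: e_fixed)
  then show "(norm (A *v x))\<^sup>2 \<le> (1 - (spectral_beta P)\<^sup>2) * (x \<bullet> e)\<^sup>2 + (spectral_beta P)\<^sup>2 * (norm x)\<^sup>2"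
    by (simp only: quadB)
qed

lemma sum_eq_inner_symmetrised: "(\<Sum>i\<in>UNIV. x $ i) = e \<bullet> symmetrised x"
  by (simp add: e_def inner_vec_def)

lemma symmetrised_tilted_step:
  "symmetrised (tilted_step P g x) = diag_mult g (A *v symmetrised x)"
  by (simp add: tilted_step_def A_symmetrised vec_eq_iff)

lemma sum_tilted_steps_le:
  assumes c: "0 \<le> c" and g: "\<And>x. norm (diag_mult g (A *v x)) \<le> c * norm x"
  shows "(\<Sum>i\<in>UNIV. ((tilted_step P g ^^ n) q) $ i) \<le> c ^ n * norm (symmetrised q)"
proof -
  have "norm (symmetrised ((tilted_step P g ^^ n) q)) \<le> c ^ n * norm (symmetrised q)"
  proof (induction n)
    case (Suc n)
    then show ?case
      using order_trans[OF g mult_left_mono[OF Suc c]] by (simp add: symmetrised_tilted_step mult_ac)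
  qed simp
  then show ?thesis
    unfolding sum_eq_inner_symmetrised
    using norm_cauchy_schwarz[of e "symmetrised ((tilted_step P g ^^ n) q)"] e_unit by simp
qed

text \<open>
  Writing the weight as a square and shifting one factor \<open>h\<close> cyclically replaces the non-symmetric
  \<open>diag (h\<^sup>2) A\<close> by the symmetric \<open>diag h A diag h\<close>. The leftover factors \<open>h\<close> and \<open>1 / h\<close> at the two ends
  account for \<open>H\<^sup>2\<close>.
\<close>

lemma sum_tilted_steps_le_sandwich:
  assumes h: "\<And>i. 0 < h i" "\<And>i. h i \<le> H" "\<And>i. 1 / h i \<le> H"
    and c: "0 \<le> c" and g: "\<And>x. norm (diag_mult h (A *v diag_mult h x)) \<le> c * norm x"
  shows "(\<Sum>i\<in>UNIV. ((tilted_step P (\<lambda>i. (h i)\<^sup>2) ^^ n) q) $ i) \<le> H\<^sup>2 * c ^ n * norm (symmetrised q)"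
proof -
  let ?B = "\<lambda>x. diag_mult h (A *v diag_mult h x)"
  let ?x = "diag_mult (\<lambda>i. 1 / h i) (symmetrised q)"
  have h0: "h i \<noteq> 0" for i using h(1)[of i] by simp
  have H: "0 \<le> H" using h(1,2)[of undefined] by simp
  have iter: "symmetrised ((tilted_step P (\<lambda>i. (h i)\<^sup>2) ^^ n) q) = diag_mult h ((?B ^^ n) ?x)"
  proof (induction n)
    case 0
    show ?case using h0 by (simp add: vec_eq_iff)
  next
    case (Suc n)
    then show ?case
      by (simp add: symmetrised_tilted_step diag_mult_diag_mult power2_eq_square)
  qed
  have "norm ((?B ^^ n) ?x) \<le> c ^ n * norm ?x"
  proof (induction n)
    case (Suc n)
    then show ?case using order_trans[OF g mult_left_mono[OF Suc c]] by (simp add: mult_ac)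
  qed simp
  also have "norm ?x \<le> H * norm (symmetrised q)"
    using h by (intro norm_diag_mult_le) (simp add: less_imp_le)
  finally have bound: "norm ((?B ^^ n) ?x) \<le> c ^ n * (H * norm (symmetrised q))"
    using c by (simp add: mult_left_mono)
  have "norm (diag_mult h e) \<le> H * norm e"
    using h by (intro norm_diag_mult_le) (simp add: less_imp_le)
  then have he: "norm (diag_mult h e) \<le> H" by (simp add: e_unit)
  have "(\<Sum>i\<in>UNIV. ((tilted_step P (\<lambda>i. (h i)\<^sup>2) ^^ n) q) $ i) = diag_mult h e \<bullet> (?B ^^ n) ?x"
    by (simp only: sum_eq_inner_symmetrised iter diag_mult_selfadjoint)
  also have "\<dots> \<le> norm (diag_mult h e) * norm ((?B ^^ n) ?x)" by (rule norm_cauchy_schwarz)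
  also have "\<dots> \<le> H * (c ^ n * (H * norm (symmetrised q)))"
    by (intro mult_mono he bound H) simp
  finally show ?thesis by (simp add: power2_eq_square mult_ac)
qed

text \<open>
  The two products are adjoint to each other and so have the same operator norm.
\<close>

lemma norm_diag_A_le:
  assumes c: "0 \<le> c" and AD: "\<And>x. norm (A *v diag_mult h x) \<le> c * norm x"
  shows "norm (diag_mult h (A *v x)) \<le> c * norm x"
proof (cases "diag_mult h (A *v x) = 0")
  case False
  let ?z = "diag_mult h (A *v x)"
  have "norm ?z * norm ?z = ?z \<bullet> diag_mult h (A *v x)"
    by (simp add: norm_eq_sqrt_inner)
  also have "\<dots> = (A *v diag_mult h ?z) \<bullet> x"
    by (simp only: diag_mult_selfadjoint[of "?z"] A_selfadjoint)
  also have "\<dots> \<le> norm (A *v diag_mult h ?z) * norm x" by (rule norm_cauchy_schwarz)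
  also have "\<dots> \<le> c * norm ?z * norm x" by (intro mult_right_mono AD) simp
  finally have "norm ?z * norm ?z \<le> norm ?z * (c * norm x)" by (simp add: mult_ac)
  then show ?thesis using False by simp
qed (use c in simp)

text \<open>
  As the entries are nonnegative, the form at \<open>\<bar>x\<bar>\<close> dominates its absolute value at \<open>x\<close>; so an upper bound is also
  a bound on the absolute value, however negative the spectrum may be.
\<close>

lemma abs_quadratic_form_A_le:
  assumes h: "\<And>i. 0 \<le> h i"
    and quad: "\<And>x. diag_mult h x \<bullet> (A *v diag_mult h x) \<le> c * (norm x)\<^sup>2"
  shows "\<bar>diag_mult h x \<bullet> (A *v diag_mult h x)\<bar> \<le> c * (norm x)\<^sup>2"
proof -
  let ?x = "\<chi> i. \<bar>x $ i\<bar>"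
  have "\<bar>diag_mult h x \<bullet> (A *v diag_mult h x)\<bar>
      \<le> diag_mult h ?x \<bullet> (A *v diag_mult h ?x)"
    unfolding inner_vec_def matrix_vector_mult_def
    by (auto simp: sum_distrib_left abs_mult h A_nonneg
        intro!: order_trans[OF sum_abs] sum_mono)
  also have "\<dots> \<le> c * (norm ?x)\<^sup>2" by (rule quad)
  also have "norm ?x = norm x" by (simp add: norm_vec_def L2_set_def)
  finally show ?thesis .
qed

end

section \<open>Exponential moments along a Markov trajectory\<close>

text \<open>
  There are finitely many histories up to time \<open>n\<close>, so a function of the history is a finite combination of
  indicators.
\<close>

lemma markov_trajectory_path_integral:
  fixes X :: "nat \<Rightarrow> 'w \<Rightarrow> 'v::finite" and H :: "(nat \<Rightarrow> 'v) \<Rightarrow> real"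
  assumes X: "markov_trajectory M P q X" and B: "B \<in> sets M"
  shows "has_bochner_integral M (\<lambda>\<omega>. H (restrict (\<lambda>k. X k \<omega>) {..n}) * indicator B \<omega>)
    (\<Sum>x\<in>{..n} \<rightarrow>\<^sub>E UNIV. H x * measure M ({\<omega>\<in>space M. \<forall>k\<le>n. X k \<omega> = x k} \<inter> B))"
proof -
  interpret prob_space M using X by (simp add: markov_trajectory_def)
  have [measurable]: "X k \<in> measurable M (count_space UNIV)" for k
    using X by (simp add: markov_trajectory_def)
  have sets: "{\<omega>\<in>space M. \<forall>k\<le>n. X k \<omega> = x k} \<inter> B \<in> sets M" for x
    using B by (intro sets.Int) measurable
  have eq: "H (restrict (\<lambda>k. X k \<omega>) {..n}) * indicator B \<omega>
      = (\<Sum>x\<in>{..n} \<rightarrow>\<^sub>E UNIV. H x * indicator ({\<omega>\<in>space M. \<forall>k\<le>n. X k \<omega> = x k} \<inter> B) \<omega>)"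
    if "\<omega> \<in> space M" for \<omega>
  proof -
    let ?r = "restrict (\<lambda>k. X k \<omega>) {..n}"
    have "(\<forall>k\<le>n. X k \<omega> = x k) \<longleftrightarrow> x = ?r" if "x \<in> {..n} \<rightarrow>\<^sub>E UNIV" for x
      using that by (auto simp: PiE_iff extensional_def fun_eq_iff restrict_def)
    then have "(\<Sum>x\<in>{..n} \<rightarrow>\<^sub>E UNIV. H x * indicator ({\<omega>\<in>space M. \<forall>k\<le>n. X k \<omega> = x k} \<inter> B) \<omega>)
      = (\<Sum>x\<in>{..n} \<rightarrow>\<^sub>E UNIV. if x = ?r then H x * indicator B \<omega> else 0)"
      using that by (intro sum.cong) (auto simp: indicator_def)
    also have "\<dots> = H ?r * indicator B \<omega>"
      by (subst sum.delta) (auto intro: finite_PiE)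
    finally show ?thesis ..
  qed
  have "has_bochner_integral M
      (\<lambda>\<omega>. \<Sum>x\<in>{..n} \<rightarrow>\<^sub>E UNIV. H x * indicator ({\<omega>\<in>space M. \<forall>k\<le>n. X k \<omega> = x k} \<inter> B) \<omega>)
      (\<Sum>x\<in>{..n} \<rightarrow>\<^sub>E UNIV. H x * measure M ({\<omega>\<in>space M. \<forall>k\<le>n. X k \<omega> = x k} \<inter> B))"
    by (intro has_bochner_integral_sum has_bochner_integral_mult_right
        has_bochner_integral_real_indicator sets) (simp add: emeasure_eq_measure)
  then show ?thesis
    by (subst has_bochner_integral_cong[OF refl eq refl])
qed

text \<open>
  The Markov property, which is given for single histories only, extended to functions of the history by
  linearity. Histories of probability zero contribute nothing to either side.
\<close>

lemma markov_property_expectation: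
  fixes X :: "nat \<Rightarrow> 'w \<Rightarrow> 'v::finite" and H :: "(nat \<Rightarrow> 'v) \<Rightarrow> real"
  assumes X: "markov_trajectory M P q X"
  shows "(\<integral>\<omega>. H (restrict (\<lambda>k. X k \<omega>) {..n}) * indicator {\<omega>\<in>space M. X (Suc n) \<omega> = i} \<omega> \<partial>M)
    = (\<Sum>j\<in>UNIV. P $ i $ j *
        (\<integral>\<omega>. H (restrict (\<lambda>k. X k \<omega>) {..n}) * indicator {\<omega>\<in>space M. X n \<omega> = j} \<omega> \<partial>M))"
proof -
  interpret prob_space M using X by (simp add: markov_trajectory_def)
  have [measurable]: "X k \<in> measurable M (count_space UNIV)" for k
    using X by (simp add: markov_trajectory_def)
  have B: "{\<omega>\<in>space M. X k \<omega> = j} \<in> sets M" for k j by measurable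
  let ?E = "\<lambda>x. {\<omega>\<in>space M. \<forall>k\<le>n. X k \<omega> = x k}"
  note int = has_bochner_integral_integral_eq[OF markov_trajectory_path_integral[OF X B]]
  have step: "prob (?E x \<inter> {\<omega>\<in>space M. X (Suc n) \<omega> = i}) = P $ i $ x n * prob (?E x)" for x
  proof (cases "prob (?E x) > 0")
    case True
    have "?E x \<inter> {\<omega>\<in>space M. X (Suc n) \<omega> = i}
        = {\<omega>\<in>space M. X (Suc n) \<omega> = i \<and> (\<forall>k\<le>n. X k \<omega> = x k)}" by auto
    moreover have "\<P>(\<omega> in M. X (Suc n) \<omega> = i \<bar> \<forall>k\<le>n. X k \<omega> = x k) = P $ i $ x n"
      using X True by (simp add: markov_trajectory_def)
    ultimately show ?thesis using True by (simp add: cond_prob_def field_simps)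
  next
    case False
    then have "prob (?E x) = 0" by (simp add: zero_less_measure_iff)
    moreover have "prob (?E x \<inter> {\<omega>\<in>space M. X (Suc n) \<omega> = i}) \<le> prob (?E x)"
      by (intro finite_measure_mono) auto
    ultimately show ?thesis by (simp add: measure_le_0_iff)
  qed
  have last: "prob (?E x \<inter> {\<omega>\<in>space M. X n \<omega> = j}) = (if j = x n then prob (?E x) else 0)" for x j
  proof -
    have "?E x \<inter> {\<omega>\<in>space M. X n \<omega> = j} = (if j = x n then ?E x else {})" by auto
    then show ?thesis by simp
  qed
  show ?thesis
    unfolding int sum_distrib_left
    by (subst sum.swap) (auto simp: step last if_distrib[of "\<lambda>z. _ * z"] mult_ac cong: if_cong)
qed

text \<open>
  The moment restricted to \<open>X n = i\<close> obeys the recursion of \<open>tilted_step\<close>.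
\<close>

lemma exponential_moment_markov:
  fixes X :: "nat \<Rightarrow> 'w \<Rightarrow> 'v::finite" and f :: "'v \<Rightarrow> real" and \<eta> :: real
  assumes X: "markov_trajectory M P q X"
  defines "W \<equiv> \<lambda>n \<omega>. exp (\<eta> * (\<Sum>k=1..n. f (X k \<omega>)))"
  shows "integrable M (W n)"
    and "(\<integral>\<omega>. W n \<omega> \<partial>M) = (\<Sum>i\<in>UNIV. ((tilted_step P (\<lambda>i. exp (\<eta> * f i)) ^^ n) q) $ i)"
proof -
  interpret prob_space M using X by (simp add: markov_trajectory_def)
  have [measurable]: "X k \<in> measurable M (count_space UNIV)" for k
    using X by (simp add: markov_trajectory_def)
  have B: "{\<omega>\<in>space M. X k \<omega> = j} \<in> sets M" for k j by measurable
  define H where "H = (\<lambda>n (x::nat \<Rightarrow> 'v). exp (\<eta> * (\<Sum>k=1..n. f (x k))))"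
  have WH: "W n \<omega> = H n (restrict (\<lambda>k. X k \<omega>) {..n})" for n \<omega>
    by (simp add: W_def H_def)
  have int: "integrable M (\<lambda>\<omega>. W n \<omega> * indicator B \<omega>)" if "B \<in> sets M" for n B
    using has_bochner_integral_iff markov_trajectory_path_integral[OF X that] unfolding WH by blast
  have "integrable M (\<lambda>\<omega>. W n \<omega> * indicator (space M) \<omega>)" by (rule int) simp
  then show "integrable M (W n)"
    by (rule Bochner_Integration.integrable_cong[THEN iffD1, OF refl, rotated]) simp
  define \<phi> where "\<phi> = (\<lambda>n i. \<integral>\<omega>. W n \<omega> * indicator {\<omega>\<in>space M. X n \<omega> = i} \<omega> \<partial>M)"
  have \<phi>: "\<phi> n i = ((tilted_step P (\<lambda>i. exp (\<eta> * f i)) ^^ n) q) $ i" for n i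
  proof (induction n arbitrary: i)
    case 0
    have "\<phi> 0 i = prob {\<omega>\<in>space M. X 0 \<omega> = i}"
      using B by (simp add: \<phi>_def W_def)
    also have "\<dots> = q $ i" using X by (simp add: markov_trajectory_def)
    finally show ?case by simp
  next
    case (Suc n)
    have "\<phi> (Suc n) i = (\<integral>\<omega>. exp (\<eta> * f i) * (W n \<omega> * indicator {\<omega>\<in>space M. X (Suc n) \<omega> = i} \<omega>) \<partial>M)"
      unfolding \<phi>_def
      by (intro Bochner_Integration.integral_cong)
        (auto simp: W_def indicator_def exp_add[symmetric] algebra_simps)
    also have "\<dots> = exp (\<eta> * f i) * (\<Sum>j\<in>UNIV. P $ i $ j * \<phi> n j)"
      unfolding \<phi>_def WH by (simp add: markov_property_expectation[OF X])
    also have "\<dots> = ((tilted_step P (\<lambda>i. exp (\<eta> * f i)) ^^ Suc n) q) $ i"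
      by (simp add: Suc.IH tilted_step_nth)
    finally show ?case .
  qed
  have "(\<integral>\<omega>. W n \<omega> \<partial>M) = (\<integral>\<omega>. (\<Sum>i\<in>UNIV. W n \<omega> * indicator {\<omega>\<in>space M. X n \<omega> = i} \<omega>) \<partial>M)"
    by (intro Bochner_Integration.integral_cong)
      (simp_all add: indicator_def if_distrib[of "\<lambda>z. _ * z"] cong: if_cong)
  also have "\<dots> = (\<Sum>i\<in>UNIV. \<phi> n i)"
    unfolding \<phi>_def by (intro Bochner_Integration.integral_sum int B)
  finally show "(\<integral>\<omega>. W n \<omega> \<partial>M) = (\<Sum>i\<in>UNIV. ((tilted_step P (\<lambda>i. exp (\<eta> * f i)) ^^ n) q) $ i)"
    by (simp add: \<phi>)
qed

lemma chernoff_markov: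
  fixes X :: "nat \<Rightarrow> 'w \<Rightarrow> 'v::finite" and f :: "'v \<Rightarrow> real" and \<eta> \<gamma> :: real
  assumes X: "markov_trajectory M P q X" and \<eta>: "0 \<le> \<eta>" and n: "1 \<le> n"
  shows "\<P>(\<omega> in M. 1 / real n * (\<Sum>k=1..n. f (X k \<omega>)) > \<gamma>)
    \<le> exp (- \<eta> * real n * \<gamma>) *
      (\<Sum>i\<in>UNIV. ((tilted_step P (\<lambda>i. exp (\<eta> * f i)) ^^ n) q) $ i)"
proof -
  interpret prob_space M using X by (simp add: markov_trajectory_def)
  have [measurable]: "X k \<in> measurable M (count_space UNIV)" for k
    using X by (simp add: markov_trajectory_def)
  let ?S = "\<lambda>\<omega>. \<Sum>k=1..n. f (X k \<omega>)"
  note moment = exponential_moment_markov[OF X, where \<eta> = \<eta> and f = f and n = n]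
  have "\<P>(\<omega> in M. 1 / real n * ?S \<omega> > \<gamma>)
      \<le> prob {\<omega>\<in>space M. exp (\<eta> * (real n * \<gamma>)) \<le> exp (\<eta> * ?S \<omega>)}"
    using n by (intro finite_measure_mono) (auto intro!: mult_left_mono \<eta> simp: field_simps)
  also have "\<dots> \<le> (\<integral>\<omega>. exp (\<eta> * ?S \<omega>) \<partial>M) / exp (\<eta> * (real n * \<gamma>))"
    by (rule integral_Markov_inequality_measure[where A = "{}"]) (use moment in auto)
  finally show ?thesis
    unfolding moment(2) by (simp add: exp_minus field_simps)
qed

section \<open>Tail bounds for reversible chains\<close>

context reversible_chain
begin

text \<open>
  The bound on \<open>A\<^sup>2\<close> controls the square of the norm of \<open>A diag h\<close>; this is why \<open>S\<^sub>n\<close> is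
  tilted with \<open>\<theta> / 2\<close> and the exponent is halved.
\<close>

lemma tail_bound_beta:
  fixes X :: "nat \<Rightarrow> 'w \<Rightarrow> 'v" and f :: "'v \<Rightarrow> real" and \<gamma> t V K u :: real
  assumes X: "markov_trajectory M P q X" and n: "1 \<le> n"
    and f: "\<And>i. \<bar>f i\<bar> \<le> 1" "(\<Sum>i\<in>UNIV. f i * s $ i) = 0" "V = (\<Sum>i\<in>UNIV. (f i)\<^sup>2 * s $ i)"
    and V: "0 < V" and z: "z \<noteq> 0" "z \<bullet> e = 0"
    and t: "1 \<le> t" and \<gamma>: "0 < \<gamma>" and \<beta>: "spectral_beta P < 1"
    and budget: "spectral_beta P \<noteq> 0 \<Longrightarrow>
      \<gamma> \<le> (t - 1) * ((1 + (spectral_beta P)\<^sup>2) / (spectral_beta P)\<^sup>2) * V"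
  defines "K \<equiv> t * (2 * ((1 + (spectral_beta P)\<^sup>2) / (1 - (spectral_beta P)\<^sup>2))) * V"
    and "u \<equiv> \<gamma> / K"
  shows "\<P>(\<omega> in M. 1 / real n * (\<Sum>k=1..n. f (X k \<omega>)) > \<gamma>)
    \<le> norm (symmetrised q) * exp (- (real n / 2) * K * ((1 + u) * ln (1 + u) - u))"
proof -
  define a where "a = (spectral_beta P)\<^sup>2"
  note beta = spectral_beta_bounds[OF z]
  have a: "0 \<le> a" "a < 1"
    using \<beta> beta(1) by (auto simp: a_def power_strict_mono[of _ 1 2, simplified] power2_less_1_iff abs_square_less_1)
  have K: "0 < K" using a t V unfolding K_def a_def[symmetric] by simp
  have u: "0 \<le> u" using K \<gamma> by (simp add: u_def)
  have small: "2 * a * u * t \<le> (t - 1) * (1 - a)"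
    unfolding u_def K_def a_def[symmetric] using budget
    by (intro spectral_budget[OF a t V]) (auto simp: a_def)
  define \<theta> where "\<theta> = ln (1 + u)"
  define \<Lambda> where "\<Lambda> = exp (K * (u - \<theta>))"
  define h where "h = (\<lambda>i. exp (\<theta> / 2 * f i))"
  note tilt = tilted_rank_one_bound[OF less_imp_le[OF s_pos] s_sum f a t u small,
      folded e_def, folded \<theta>_def, folded h_def]
  have "norm (A *v diag_mult h x) \<le> sqrt \<Lambda> * norm x" for x
  proof -
    have "(norm (A *v diag_mult h x))\<^sup>2 \<le> \<Lambda> * (norm x)\<^sup>2"
      using order_trans[OF beta(2)[of "diag_mult h x", folded a_def] tilt[of x]]
      by (simp add: \<Lambda>_def K_def a_def)
    then have "sqrt ((norm (A *v diag_mult h x))\<^sup>2) \<le> sqrt (\<Lambda> * (norm x)\<^sup>2)"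
      by (rule real_sqrt_le_mono)
    then show ?thesis by (simp add: real_sqrt_mult)
  qed
  then have "norm (diag_mult h (A *v x)) \<le> sqrt \<Lambda> * norm x" for x
    by (intro norm_diag_A_le) (auto simp: \<Lambda>_def)
  then have sum: "(\<Sum>i\<in>UNIV. ((tilted_step P h ^^ n) q) $ i) \<le> sqrt \<Lambda> ^ n * norm (symmetrised q)"
    by (intro sum_tilted_steps_le) (auto simp: \<Lambda>_def)
  have \<theta>: "0 \<le> \<theta> / 2" using u by (simp add: \<theta>_def)
  have "\<P>(\<omega> in M. 1 / real n * (\<Sum>k=1..n. f (X k \<omega>)) > \<gamma>)
      \<le> exp (- (\<theta> / 2) * real n * \<gamma>) * (\<Sum>i\<in>UNIV. ((tilted_step P h ^^ n) q) $ i)"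
    unfolding h_def by (rule chernoff_markov[OF X \<theta> n])
  also have "\<dots> \<le> exp (- (\<theta> / 2) * real n * \<gamma>) * (sqrt \<Lambda> ^ n * norm (symmetrised q))"
    using sum by (intro mult_left_mono) auto
  also have "sqrt \<Lambda> = exp (K * (u - \<theta>) / 2)"
    by (rule real_sqrt_unique) (auto simp: \<Lambda>_def exp_double[symmetric])
  also have "exp (K * (u - \<theta>) / 2) ^ n = exp (real n * (K * (u - \<theta>) / 2))"
    by (rule exp_of_nat_mult[symmetric])
  also have "exp (- (\<theta> / 2) * real n * \<gamma>) * (exp (real n * (K * (u - \<theta>) / 2)) * norm (symmetrised q))
      = norm (symmetrised q) * exp (- (\<theta> / 2) * real n * \<gamma> + real n * (K * (u - \<theta>) / 2))"
    by (simp only: exp_add mult_ac)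
  also have "- (\<theta> / 2) * real n * \<gamma> + real n * (K * (u - \<theta>) / 2)
      = - (real n / 2) * K * ((1 + u) * \<theta> - u)"
  proof -
    have "\<gamma> = K * u" using K by (simp add: u_def)
    then show ?thesis by (simp add: field_simps)
  qed
  finally show ?thesis by (simp add: \<theta>_def)
qed

text \<open>
  Here the tilt is the full \<open>\<theta>\<close>, split evenly between the two sides of \<open>A\<close>; the ends contribute
  \<open>exp \<theta> = 1 + u\<close>.
\<close>

lemma tail_bound_alpha:
  fixes X :: "nat \<Rightarrow> 'w \<Rightarrow> 'v" and f :: "'v \<Rightarrow> real" and \<gamma> t V K u :: real
  assumes X: "markov_trajectory M P q X" and n: "1 \<le> n"
    and f: "\<And>i. \<bar>f i\<bar> \<le> 1" "(\<Sum>i\<in>UNIV. f i * s $ i) = 0" "V = (\<Sum>i\<in>UNIV. (f i)\<^sup>2 * s $ i)"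
    and V: "0 < V" and z: "z \<noteq> 0" "z \<bullet> e = 0"
    and t: "1 \<le> t" and \<gamma>: "0 < \<gamma>"
    and budget: "spectral_alpha P \<noteq> 0 \<Longrightarrow>
      \<gamma> \<le> (t - 1) * ((1 + spectral_alpha P) / spectral_alpha P) * V"
  defines "K \<equiv> t * (2 * ((1 + spectral_alpha P) / (1 - spectral_alpha P))) * V"
    and "u \<equiv> \<gamma> / K"
  shows "\<P>(\<omega> in M. 1 / real n * (\<Sum>k=1..n. f (X k \<omega>)) > \<gamma>)
    \<le> (1 + u) * norm (symmetrised q) * exp (- real n * K * ((1 + u) * ln (1 + u) - u))"
proof -
  define a where "a = spectral_alpha P"
  note alpha = spectral_alpha_bounds[OF z, folded a_def]
  note a = alpha(1,2)
  have K: "0 < K" using a t V unfolding K_def a_def[symmetric] by simp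
  have u: "0 \<le> u" using K \<gamma> by (simp add: u_def)
  have small: "2 * a * u * t \<le> (t - 1) * (1 - a)"
    unfolding u_def K_def a_def[symmetric] using budget
    by (intro spectral_budget[OF a t V]) (auto simp: a_def)
  define \<theta> where "\<theta> = ln (1 + u)"
  define \<Lambda> where "\<Lambda> = exp (K * (u - \<theta>))"
  define h where "h = (\<lambda>i. exp (\<theta> / 2 * f i))"
  note tilt = tilted_rank_one_bound[OF less_imp_le[OF s_pos] s_sum f a t u small,
      folded e_def, folded \<theta>_def, folded h_def]
  have \<theta>: "0 \<le> \<theta>" "exp \<theta> = 1 + u" using u by (auto simp: \<theta>_def)
  have "diag_mult h x \<bullet> (A *v diag_mult h x) \<le> \<Lambda> * (norm x)\<^sup>2" for x
    using order_trans[OF alpha(3)[of "diag_mult h x"] tilt[of x]]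
    by (simp add: \<Lambda>_def K_def a_def)
  then have "\<bar>diag_mult h x \<bullet> (A *v diag_mult h x)\<bar> \<le> \<Lambda> * (norm x)\<^sup>2" for x
    by (intro abs_quadratic_form_A_le) (auto simp: h_def)
  then have "norm (diag_mult h (A *v diag_mult h x)) \<le> \<Lambda> * norm x" for x
    by (intro norm_bound_of_quadratic_form[where B = "\<lambda>x. diag_mult h (A *v diag_mult h x)"]
        linear_compose[OF linear_compose[OF linear_diag_mult linear_A] linear_diag_mult, unfolded o_def])
      (auto simp: diag_mult_selfadjoint A_selfadjoint \<Lambda>_def)
  then have "(\<Sum>i\<in>UNIV. ((tilted_step P (\<lambda>i. (h i)\<^sup>2) ^^ n) q) $ i)
      \<le> (exp (\<theta> / 2))\<^sup>2 * \<Lambda> ^ n * norm (symmetrised q)"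
  proof (rule sum_tilted_steps_le_sandwich[rotated 4])
    fix i
    have fi: "- 1 \<le> f i" "f i \<le> 1" using f(1)[of i] by auto
    show "0 < h i" by (simp add: h_def)
    show "h i \<le> exp (\<theta> / 2)" using fi mult_left_mono[OF fi(2), of \<theta>] \<theta> by (simp add: h_def)
    have "1 / h i = exp (\<theta> / 2 * - f i)" by (simp add: h_def exp_minus field_simps)
    then show "1 / h i \<le> exp (\<theta> / 2)"
      using fi mult_left_mono[OF fi(1), of \<theta>] \<theta> by simp
  qed (simp add: \<Lambda>_def)
  moreover have "(\<lambda>i. (h i)\<^sup>2) = (\<lambda>i. exp (\<theta> * f i))"
    by (simp add: h_def exp_double[symmetric])
  moreover have "(exp (\<theta> / 2))\<^sup>2 = 1 + u" using \<theta>(2) by (simp add: exp_double[symmetric])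
  ultimately have sum: "(\<Sum>i\<in>UNIV. ((tilted_step P (\<lambda>i. exp (\<theta> * f i)) ^^ n) q) $ i)
      \<le> (1 + u) * \<Lambda> ^ n * norm (symmetrised q)" by simp
  have "\<P>(\<omega> in M. 1 / real n * (\<Sum>k=1..n. f (X k \<omega>)) > \<gamma>)
      \<le> exp (- \<theta> * real n * \<gamma>) * (\<Sum>i\<in>UNIV. ((tilted_step P (\<lambda>i. exp (\<theta> * f i)) ^^ n) q) $ i)"
    by (rule chernoff_markov[OF X \<theta>(1) n])
  also have "\<dots> \<le> exp (- \<theta> * real n * \<gamma>) * ((1 + u) * \<Lambda> ^ n * norm (symmetrised q))"
    using sum by (intro mult_left_mono) auto
  also have "\<Lambda> ^ n = exp (real n * (K * (u - \<theta>)))"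
    unfolding \<Lambda>_def by (rule exp_of_nat_mult[symmetric])
  also have "exp (- \<theta> * real n * \<gamma>) * ((1 + u) * exp (real n * (K * (u - \<theta>))) * norm (symmetrised q))
      = (1 + u) * norm (symmetrised q) * exp (- \<theta> * real n * \<gamma> + real n * (K * (u - \<theta>)))"
    by (simp only: exp_add mult_ac)
  also have "- \<theta> * real n * \<gamma> + real n * (K * (u - \<theta>)) = - real n * K * ((1 + u) * \<theta> - u)"
  proof -
    have "\<gamma> = K * u" using K by (simp add: u_def)
    then show ?thesis by (simp add: algebra_simps)
  qed
  finally show ?thesis by (simp add: \<theta>_def)
qed

end

section \<open>Random walks on connected weighted graphs\<close>

lemma connected_graph_degree_pos:
  fixes w :: "'v::finite \<Rightarrow> 'v \<Rightarrow> real"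
  assumes w: "weighted_graph w" and conn: "connected_graph w" and ij: "i \<noteq> j"
  shows "0 < (\<Sum>k\<in>UNIV. w i k)"
proof -
  have "(\<lambda>x y. 0 < w x y)\<^sup>*\<^sup>* i j" using conn by (simp add: connected_graph_def)
  then obtain k where "0 < w i k" using ij by (cases rule: converse_rtranclpE) auto
  then show ?thesis using w by (intro sum_pos2[of _ k]) (auto simp: weighted_graph_def)
qed

text \<open>
  The Dirichlet form \<open>\<Sum>i j. w i j (g i - g j)\<^sup>2\<close> vanishes, so \<open>g\<close> is constant along edges.
\<close>

lemma harmonic_constant:
  fixes w :: "'v::finite \<Rightarrow> 'v \<Rightarrow> real"
  assumes w: "weighted_graph w" and conn: "connected_graph w"
    and g: "\<And>i. (\<Sum>j\<in>UNIV. w i j * (g i - g j)) = 0"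
  shows "g i = g j"
proof -
  have sym: "w i j = w j i" and nonneg: "0 \<le> w i j" for i j
    using w by (auto simp: weighted_graph_def)
  have "(\<Sum>i\<in>UNIV. \<Sum>j\<in>UNIV. w i j * (g i - g j)\<^sup>2)
      = (\<Sum>i\<in>UNIV. \<Sum>j\<in>UNIV. g i * (w i j * (g i - g j)))
      + (\<Sum>i\<in>UNIV. \<Sum>j\<in>UNIV. g j * (w j i * (g j - g i)))"
    by (simp add: sum.distrib[symmetric] sym[of _ "_::'v"] power2_eq_square)
      (intro sum.cong refl, simp add: sym algebra_simps)
  also have "\<dots> = 0"
    by (subst (2) sum.swap) (simp add: sum_distrib_left[symmetric] g)
  finally have "w i j * (g i - g j)\<^sup>2 = 0" for i j
    using nonneg by (simp add: sum_nonneg_eq_0_iff sum_nonneg)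
  then have edge: "g x = g y" if "0 < w x y" for x y
    using that by (metis eq_iff_diff_eq_0 less_irrefl mult_eq_0_iff power_eq_0_iff)
  have "(\<lambda>x y. 0 < w x y)\<^sup>*\<^sup>* i j" using conn by (simp add: connected_graph_def)
  then show ?thesis by induction (auto dest: edge)
qed

text \<open>
  Dividing by the degrees turns fixed vectors of the transition matrix into harmonic functions. Hence every fixed
  vector is a multiple of the degree vector, which gives at once the shape of \<open>s\<close>, detailed balance and the
  simplicity of the eigenvalue 1. Two distinct vertices guarantee, by connectedness, that the degrees are positive.
\<close>

lemma connected_graph_reversible_chain:
  fixes w :: "'v::finite \<Rightarrow> 'v \<Rightarrow> real" and s :: "real^'v"
  assumes w: "weighted_graph w" and conn: "connected_graph w"
    and s: "stationary_distribution (transition_matrix w) s"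
    and two: "\<exists>i j :: 'v. i \<noteq> j"
  shows "reversible_chain (transition_matrix w) s"
proof -
  have sym: "w i j = w j i" and nonneg: "0 \<le> w i j" for i j
    using w by (auto simp: weighted_graph_def)
  define d where "d = (\<lambda>i. \<Sum>k\<in>UNIV. w i k)"
  have d: "0 < d i" for i
  proof -
    obtain j where "i \<noteq> j" using two by metis
    then show ?thesis unfolding d_def by (rule connected_graph_degree_pos[OF w conn])
  qed
  then have d0: "d i \<noteq> 0" for i by (metis less_irrefl)
  let ?P = "transition_matrix w"
  have P: "?P $ i $ j = w j i / d j" for i j by (simp add: transition_matrix_def d_def)
  have fixed: "\<exists>c. \<forall>i. v $ i = c * d i" if v: "?P *v v = v" for v
  proof -
    define g where "g = (\<lambda>i. v $ i / d i)"
    have "(\<Sum>j\<in>UNIV. w i j * (g i - g j)) = 0" for i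
    proof -
      have "(\<Sum>j\<in>UNIV. w i j * g j) = (?P *v v) $ i"
        by (simp add: matrix_vector_mult_def P g_def sym[of i])
      also have "\<dots> = d i * g i" by (simp add: v g_def d0)
      finally show ?thesis
        by (simp add: right_diff_distrib sum_subtractf sum_distrib_right[symmetric] d_def)
    qed
    then have "g i = g j" for i j by (rule harmonic_constant[OF w conn])
    then have "v $ i = g undefined * d i" for i
      using d0[of i] by (metis g_def nonzero_eq_divide_eq)
    then show ?thesis by blast
  qed
  have s': "\<And>i. 0 \<le> s $ i" "(\<Sum>i\<in>UNIV. s $ i) = 1" "?P *v s = s"
    using s by (auto simp: stationary_distribution_def prob_vector_def)
  obtain c where c: "\<And>i. s $ i = c * d i" using fixed[OF s'(3)] by blast
  have "c \<noteq> 0" using s'(2) c by auto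
  moreover have "0 \<le> c" using s'(1)[of undefined] d[of undefined] by (simp add: c zero_le_mult_iff)
  ultimately have c0: "0 < c" by simp
  show ?thesis
  proof
    show "0 < s $ i" for i using c0 d by (simp add: c)
    show "(\<Sum>i\<in>UNIV. s $ i) = 1" by (rule s'(2))
    show "0 \<le> ?P $ i $ j" for i j using nonneg d by (simp add: P less_imp_le)
    show "(\<Sum>i\<in>UNIV. ?P $ i $ j) = 1" for j
      using d0[of j] by (simp add: P sum_divide_distrib[symmetric]) (simp add: d_def)
    show "s $ j * ?P $ i $ j = s $ i * ?P $ j $ i" for i j
      using sym[of i j] by (simp add: P c d0)
    show "\<exists>c. v = c *\<^sub>R s" if v: "?P *v v = v" for v
    proof -
      obtain c' where "\<And>i. v $ i = c' * d i" using fixed[OF v] by blast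
      then have "v = (c' / c) *\<^sub>R s" using c0 by (simp add: vec_eq_iff c)
      then show ?thesis by blast
    qed
  qed
qed

text \<open>
  The vector \<open>z = f sqrt s\<close> is nonzero and orthogonal to \<open>e\<close>: the function \<open>f\<close> itself shows that the graph has
  at least two vertices and \<open>P\<close> an eigenvalue other than 1.
\<close>

theorem corollary2:
  fixes w :: "'v::finite \<Rightarrow> 'v \<Rightarrow> real"
    and P :: "real^'v^'v" and s q :: "real^'v" and f :: "'v \<Rightarrow> real"
    and M :: "'w measure" and X :: "nat \<Rightarrow> 'w \<Rightarrow> 'v" and S :: "nat \<Rightarrow> 'w \<Rightarrow> real"
    and n :: nat and \<gamma> t \<alpha> \<beta> V C\<^sub>\<alpha> C\<^sub>\<beta> Q :: real
  assumes "weighted_graph w" and "connected_graph w"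
  defines "P \<equiv> transition_matrix w"
  assumes "stationary_distribution P s"
  defines "\<alpha> \<equiv> spectral_alpha P" and "\<beta> \<equiv> spectral_beta P"
  assumes "Max (range (\<lambda>i. \<bar>f i\<bar>)) = 1" and "(\<Sum>i\<in>UNIV. f i * s $ i) = 0"
  defines "V \<equiv> (\<Sum>i\<in>UNIV. (f i)\<^sup>2 * s $ i)"
  assumes "prob_vector q" and "markov_trajectory M P q X"
  defines "S \<equiv> (\<lambda>m \<omega>. \<Sum>i=1..m. f (X i \<omega>))"
    and "Q \<equiv> norm (\<chi> i. q $ i / sqrt (s $ i))"
  assumes "n \<ge> 1" and "\<gamma> > 0" and "t \<ge> 1"
  defines "C\<^sub>\<beta> \<equiv> 2 * ((1 + \<beta>\<^sup>2) / (1 - \<beta>\<^sup>2))"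
    and "C\<^sub>\<alpha> \<equiv> 2 * ((1 + \<alpha>) / (1 - \<alpha>))"
  shows
    "(\<beta> < 1 \<and> (\<beta> \<noteq> 0 \<longrightarrow> \<gamma> \<le> (t - 1) * ((1 + \<beta>\<^sup>2) / \<beta>\<^sup>2) * V) \<longrightarrow>
        \<P>(\<omega> in M. 1 / real n * S n \<omega> > \<gamma>)
          \<le> Q * exp (- (real n / 2) * (t * C\<^sub>\<beta> * V) *
               ((1 + \<gamma> / (t * C\<^sub>\<beta> * V)) * ln (1 + \<gamma> / (t * C\<^sub>\<beta> * V)) - \<gamma> / (t * C\<^sub>\<beta> * V))) \<and>
        Q * exp (- (real n / 2) * (t * C\<^sub>\<beta> * V) *
               ((1 + \<gamma> / (t * C\<^sub>\<beta> * V)) * ln (1 + \<gamma> / (t * C\<^sub>\<beta> * V)) - \<gamma> / (t * C\<^sub>\<beta> * V)))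
          \<le> Q * exp (- (real n / 2) * \<gamma> * ln (\<gamma> / (exp 1 * t * C\<^sub>\<beta> * V)))) \<and>
     ((\<alpha> \<noteq> 0 \<longrightarrow> \<gamma> \<le> (t - 1) * ((1 + \<alpha>) / \<alpha>) * V) \<longrightarrow>
        \<P>(\<omega> in M. 1 / real n * S n \<omega> > \<gamma>)
          \<le> (1 + \<gamma> / (t * C\<^sub>\<alpha> * V)) * Q * exp (- real n * (t * C\<^sub>\<alpha> * V) *
               ((1 + \<gamma> / (t * C\<^sub>\<alpha> * V)) * ln (1 + \<gamma> / (t * C\<^sub>\<alpha> * V)) - \<gamma> / (t * C\<^sub>\<alpha> * V))) \<and>
        (1 + \<gamma> / (t * C\<^sub>\<alpha> * V)) * Q * exp (- real n * (t * C\<^sub>\<alpha> * V) *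
               ((1 + \<gamma> / (t * C\<^sub>\<alpha> * V)) * ln (1 + \<gamma> / (t * C\<^sub>\<alpha> * V)) - \<gamma> / (t * C\<^sub>\<alpha> * V)))
          \<le> (1 + \<gamma> / (t * C\<^sub>\<alpha> * V)) * Q * exp (- real n * \<gamma> * ln (\<gamma> / (exp 1 * t * C\<^sub>\<alpha> * V))))"
proof -
  have f1: "\<bar>f i\<bar> \<le> 1" for i
    using assms(7) Max_ge[of "range (\<lambda>i. \<bar>f i\<bar>)" "\<bar>f i\<bar>"] by simp
  have "1 \<in> range (\<lambda>i. \<bar>f i\<bar>)" using Max_in[of "range (\<lambda>i. \<bar>f i\<bar>)"] assms(7) by simp
  then obtain i0 where i0: "\<bar>f i0\<bar> = 1" by force
  have mean: "(\<Sum>i\<in>UNIV. f i * s $ i) = 0" by fact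
  have stat: "stationary_distribution (transition_matrix w) s"
    using assms(4) by (simp add: P_def)
  \<comment> \<open>On a single vertex a function with mean zero vanishes.\<close>
  have two: "\<exists>i j :: 'v. i \<noteq> j"
  proof (rule ccontr)
    assume "\<not> ?thesis"
    then have all: "i = i0" for i by blast
    have "(\<Sum>i\<in>UNIV. f i * s $ i) = (\<Sum>i\<in>UNIV. f i0 * s $ i)"
      by (intro sum.cong refl) (metis all)
    then have "f i0 * (\<Sum>i\<in>UNIV. s $ i) = 0" using mean by (simp add: sum_distrib_left)
    then show False using stat i0 by (simp add: stationary_distribution_def prob_vector_def)
  qed
  interpret reversible_chain P s
    unfolding P_def by (rule connected_graph_reversible_chain[OF assms(1,2) stat two])
  have V: "0 < V"
    unfolding V_def
    by (rule sum_pos2[of _ i0]) (use i0 s_pos in \<open>auto simp: less_imp_le\<close>)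
  define z where "z = (\<chi> i. f i * sqrt (s $ i))"
  have "z $ i0 \<noteq> 0" using i0 by (auto simp: z_def)
  then have z: "z \<noteq> 0" by auto
  have ze: "z \<bullet> e = 0" using mean by (simp add: z_def e_def inner_vec_def mult.assoc)
  have Q: "Q = norm (symmetrised q)"
    by (simp add: Q_def diag_mult_def)
  have Q0: "0 \<le> Q" by (simp add: Q)
  have \<alpha>: "0 \<le> \<alpha>" "\<alpha> < 1" using spectral_alpha_bounds[OF z ze] by (simp_all add: \<alpha>_def)
  have \<beta>: "0 \<le> \<beta>" using spectral_beta_bounds[OF z ze] by (simp add: \<beta>_def)
  have weaken: "- c * K * ((1 + \<gamma> / K) * ln (1 + \<gamma> / K) - \<gamma> / K) \<le> - c * \<gamma> * ln (\<gamma> / (exp 1 * t * C * V))"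
    if "K = t * C * V" "0 < C" "0 \<le> c" for c C K
  proof -
    have "0 < K" using that V \<open>t \<ge> 1\<close> by simp
    from mult_left_mono[OF bennett_exponent_ge[OF this \<open>\<gamma> > 0\<close>] that(3)]
    show ?thesis by (simp add: that(1) mult_ac)
  qed
  show ?thesis
  proof (intro conjI impI; (elim conjE)?)
    assume \<beta>1: "\<beta> < 1" and b: "\<beta> \<noteq> 0 \<longrightarrow> \<gamma> \<le> (t - 1) * ((1 + \<beta>\<^sup>2) / \<beta>\<^sup>2) * V"
    show "\<P>(\<omega> in M. 1 / real n * S n \<omega> > \<gamma>)
          \<le> Q * exp (- (real n / 2) * (t * C\<^sub>\<beta> * V) *
               ((1 + \<gamma> / (t * C\<^sub>\<beta> * V)) * ln (1 + \<gamma> / (t * C\<^sub>\<beta> * V)) - \<gamma> / (t * C\<^sub>\<beta> * V)))"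
      unfolding S_def Q C\<^sub>\<beta>_def \<beta>_def
      by (rule tail_bound_beta[OF _ _ f1 mean _ V z ze])
        (use assms \<beta>1 b in \<open>auto simp: V_def \<beta>_def\<close>)
    have "\<beta>\<^sup>2 < 1" using \<beta> \<beta>1 by (simp add: abs_square_less_1)
    then have "0 < C\<^sub>\<beta>" by (simp add: C\<^sub>\<beta>_def add_pos_nonneg)
    then show "Q * exp (- (real n / 2) * (t * C\<^sub>\<beta> * V) *
               ((1 + \<gamma> / (t * C\<^sub>\<beta> * V)) * ln (1 + \<gamma> / (t * C\<^sub>\<beta> * V)) - \<gamma> / (t * C\<^sub>\<beta> * V)))
          \<le> Q * exp (- (real n / 2) * \<gamma> * ln (\<gamma> / (exp 1 * t * C\<^sub>\<beta> * V)))"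
      using weaken[OF refl, of C\<^sub>\<beta> "real n / 2"] Q0 by (intro mult_left_mono) auto
  next
    assume b: "\<alpha> \<noteq> 0 \<longrightarrow> \<gamma> \<le> (t - 1) * ((1 + \<alpha>) / \<alpha>) * V"
    show "\<P>(\<omega> in M. 1 / real n * S n \<omega> > \<gamma>)
          \<le> (1 + \<gamma> / (t * C\<^sub>\<alpha> * V)) * Q * exp (- real n * (t * C\<^sub>\<alpha> * V) *
               ((1 + \<gamma> / (t * C\<^sub>\<alpha> * V)) * ln (1 + \<gamma> / (t * C\<^sub>\<alpha> * V)) - \<gamma> / (t * C\<^sub>\<alpha> * V)))"
      unfolding S_def Q C\<^sub>\<alpha>_def \<alpha>_def
      by (rule tail_bound_alpha[OF _ _ f1 mean _ V z ze])
        (use assms b in \<open>auto simp: V_def \<alpha>_def\<close>)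
    have C: "0 < C\<^sub>\<alpha>" using \<alpha> by (simp add: C\<^sub>\<alpha>_def)
    then have "0 \<le> \<gamma> / (t * C\<^sub>\<alpha> * V)" using V \<open>\<gamma> > 0\<close> \<open>t \<ge> 1\<close> by simp
    then show "(1 + \<gamma> / (t * C\<^sub>\<alpha> * V)) * Q * exp (- real n * (t * C\<^sub>\<alpha> * V) *
               ((1 + \<gamma> / (t * C\<^sub>\<alpha> * V)) * ln (1 + \<gamma> / (t * C\<^sub>\<alpha> * V)) - \<gamma> / (t * C\<^sub>\<alpha> * V)))
          \<le> (1 + \<gamma> / (t * C\<^sub>\<alpha> * V)) * Q * exp (- real n * \<gamma> * ln (\<gamma> / (exp 1 * t * C\<^sub>\<alpha> * V)))"
      using weaken[OF refl C, of "real n"] Q0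
      by (intro mult_left_mono mult_nonneg_nonneg) auto
  qed
qed

end
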